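(* Let $A$ be a densely defined symmetric operator on a complex Hilbert space $\mathcal{H}$ and let $S_1,S_2$ be bounded self-adjoint linear operators on $\mathcal{H}$ such that $S_2$ is in addition strictly positive. Define an indefinite inner product on $\operatorname{dom}A^*$ by $$[u\mid v]_A:=i\bigl(\langle A^*u\mid v\rangle-\langle u\mid A^*v\rangle\bigr),\qquad u,v\in\operatorname{dom}A^*.$$ Then the following holds. (i) $\dim\ker(A^*-S_1-iS_2)=d_+(A)$ and $\dim\ker(A^*-S_1+iS_2)=d_-(A)$, where $d_\pm(A)$ denote the deficiency indices of $A$. (ii) $\operatorname{dom}A^*=\operatorname{dom}\overline{A}\dotplus\ker(A^*-S_1-iS_2)\dotplus\ker(A^*-S_1+iS_2)$, where the sums are direct and all spaces on the right-hand side are pairwise $[\cdot\mid\cdot]_A$-orthogonal. (iii) There is a one-to-one correspondence between all closed symmetric realisations of $A$ and all unitary transformations $U$ between any closed isomorphic subspaces of $(\ker(A^*-S_1+iS_2),[\cdot\mid\cdot]_A)$ and $(\ker(A^*-S_1-iS_2),-[\cdot\mid\cdot]_A)$, respectively. (iv) There is a one-to-one correspondence between all self-adjoint realisations of $A$ and all unitary transformations $U:(\ker(A^*-S_1+iS_2),[\cdot\mid\cdot]_A)\to(\ker(A^*-S_1-iS_2),-[\cdot\mid\cdot]_A)$. (v) The correspondences of parts (iii) and (iv) can be expressed by $U\mapsto A_U=A^*|_{\operatorname{dom}A_U}$, where $$\operatorname{dom}A_U:=\{u_0+U\tilde\nu+\tilde\nu : u_0\in\operatorname{dom}\overline{A},\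 \tilde\nu\in\operatorname{dom}U\}$$ and $A_U(u_0+U\tilde\nu+\tilde\nu)=\overline{A}u_0+(S_1-iS_2)\tilde\nu+(S_1+iS_2)U\tilde\nu$.
   Context: $\langle\cdot\mid\cdot\rangle$ is the scalar product of $\mathcal{H}$, anti-linear in the second entry. A bounded self-adjoint operator $S_2$ is strictly positive if there is $\mu>0$ with $\langle S_2u\mid u\rangle\ge\mu\|u\|^2$ for all $u\in\mathcal{H}$. The deficiency indices are $d_+(A)=\dim\ker(A^*-i\beta\mathbb{1})$ and $d_-(A)=\dim\ker(A^*+i\beta\mathbb{1})$ for any $\beta>0$ (independent of $\beta$), where $\dim$ is the Hilbert space dimension (a cardinal number). A realisation of $A$ is an operator $B$ with $A\subseteq B\subseteq A^*$. A unitary transformation is a linear surjective isometry between Hilbert spaces; $(\ker(A^*-S_1+iS_2),[\cdot\mid\cdot]_A)$ and $(\ker(A^*-S_1-iS_2),-[\cdot\mid\cdot]_A)$ are Hilbert spaces with norms equivalent to the norm of $\mathcal{H}$. *)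

theory Defs
  imports "HOL-Analysis.Analysis"
begin

text \<open>
  Complex Hilbert spaces.  The scalar product is linear in the first and anti-linear in the
  second entry.  Completeness and the norm axioms come from the superclass \<open>banach\<close>; the zero
  space is allowed and nothing is assumed about separability.
\<close>

class chilbert_space = banach +
  fixes scaleC :: "complex \<Rightarrow> 'a \<Rightarrow> 'a"  (infixr \<open>*\<^sub>C\<close> 75)
    and cinner :: "'a \<Rightarrow> 'a \<Rightarrow> complex"
  assumes scaleC_add_right: "c *\<^sub>C (x + y) = c *\<^sub>C x + c *\<^sub>C y"
    and scaleC_add_left: "(c + d) *\<^sub>C x = c *\<^sub>C x + d *\<^sub>C x"
    and scaleC_scaleC: "c *\<^sub>C (d *\<^sub>C x) = (c * d) *\<^sub>C x"
    and scaleC_of_real: "complex_of_real r *\<^sub>C x = r *\<^sub>R x"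
    and cinner_commute: "cinner x y = cnj (cinner y x)"
    and cinner_add_left: "cinner (x + y) z = cinner x z + cinner y z"
    and cinner_scaleC_left: "cinner (c *\<^sub>C x) y = c * cinner x y"
    and cinner_self: "cinner x x = complex_of_real ((norm x)\<^sup>2)"

instantiation complex :: chilbert_space
begin

definition scaleC_complex :: "complex \<Rightarrow> complex \<Rightarrow> complex" where
  "scaleC_complex c x = c * x"

definition cinner_complex :: "complex \<Rightarrow> complex \<Rightarrow> complex" where
  "cinner_complex x y = x * cnj y"

instance
  by standard
    (simp_all add: scaleC_complex_def cinner_complex_def algebra_simps scaleR_conv_of_real
      complex_norm_square[symmetric])

end

global_interpretation complex_vector:
  vector_space "scaleC :: complex \<Rightarrow> 'h \<Rightarrow> 'h::chilbert_space"
  defines csubspace = complex_vector.subspace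
    and cspan = complex_vector.span
proof
  fix x :: 'h
  show "1 *\<^sub>C x = x"
    using scaleC_of_real[of 1 x] by simp
qed (simp_all add: scaleC_add_right scaleC_add_left scaleC_scaleC)

text \<open>
  Hilbert space dimension: the cardinality of an orthonormal basis, as a cardinal in the sense of
  \<open>card_of\<close>.  Cardinals are compared with the library relation \<open>ordIso\<close>, written \<open>=o\<close>.
  Intended for closed subspaces \<open>M\<close>; these have orthonormal bases, any two of which are
  equinumerous.
\<close>

notation ordIso2 (infix \<open>=o\<close> 50)

definition orthonormal_basis :: "'h::chilbert_space set \<Rightarrow> 'h set \<Rightarrow> bool" where
  "orthonormal_basis M B \<longleftrightarrow>
     (\<forall>x\<in>B. norm x = 1) \<and> (\<forall>x\<in>B. \<forall>y\<in>B. x \<noteq> y \<longrightarrow> cinner x y = 0) \<and>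
     closure (cspan B) = M"

definition hilbert_dim :: "'h::chilbert_space set \<Rightarrow> 'h rel" where
  "hilbert_dim M = card_of (SOME B. orthonormal_basis M B)"

text \<open>
  A (possibly unbounded) operator is a partial map whose domain is a complex subspace and which
  is linear there.  Hence \<open>dom\<close>, extension \<open>\<subseteq>\<^sub>m\<close> and restriction \<open>|`\<close> are the library's, and two
  operators are equal iff they have the same domain and the same values on it.
\<close>

definition linear_op :: "('h::chilbert_space \<rightharpoonup> 'h) \<Rightarrow> bool" where
  "linear_op B \<longleftrightarrow> csubspace (dom B) \<and>
     (\<forall>u\<in>dom B. \<forall>v\<in>dom B. the (B (u + v)) = the (B u) + the (B v)) \<and>
     (\<forall>c. \<forall>u\<in>dom B. the (B (c *\<^sub>C u)) = c *\<^sub>C the (B u))"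

definition densely_defined :: "('h::chilbert_space \<rightharpoonup> 'h) \<Rightarrow> bool" where
  "densely_defined B \<longleftrightarrow> closure (dom B) = UNIV"

definition symmetric_op :: "('h::chilbert_space \<rightharpoonup> 'h) \<Rightarrow> bool" where
  "symmetric_op B \<longleftrightarrow>
     (\<forall>u\<in>dom B. \<forall>v\<in>dom B. cinner (the (B u)) v = cinner u (the (B v)))"

definition closed_op :: "('h::chilbert_space \<rightharpoonup> 'h) \<Rightarrow> bool" where
  "closed_op B \<longleftrightarrow> closed (Map.graph B)"

text \<open>
  The partial map with graph \<open>G\<close>.  Below, \<open>G\<close> is single-valued exactly when the adjoint of a
  densely defined operator, resp. the closure of a closable operator, is formed.
\<close>

definition op_of_graph :: "('h \<times> 'h) set \<Rightarrow> ('h \<rightharpoonup> 'h)" where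
  "op_of_graph G = (\<lambda>u. if \<exists>!w. (u, w) \<in> G then Some (THE w. (u, w) \<in> G) else None)"

definition adjoint_op :: "('h::chilbert_space \<rightharpoonup> 'h) \<Rightarrow> ('h \<rightharpoonup> 'h)" where
  "adjoint_op B = op_of_graph {(v, w). \<forall>u\<in>dom B. cinner (the (B u)) v = cinner u w}"

definition closure_op :: "('h::chilbert_space \<rightharpoonup> 'h) \<Rightarrow> ('h \<rightharpoonup> 'h)" where
  "closure_op B = op_of_graph (closure (Map.graph B))"

definition selfadjoint_op :: "('h::chilbert_space \<rightharpoonup> 'h) \<Rightarrow> bool" where
  "selfadjoint_op B \<longleftrightarrow> densely_defined B \<and> adjoint_op B = B"

definition realisation :: "('h::chilbert_space \<rightharpoonup> 'h) \<Rightarrow> ('h \<rightharpoonup> 'h) \<Rightarrow> bool" where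
  "realisation A B \<longleftrightarrow> linear_op B \<and> A \<subseteq>\<^sub>m B \<and> B \<subseteq>\<^sub>m adjoint_op A"

definition bounded_selfadjoint :: "('h::chilbert_space \<Rightarrow> 'h) \<Rightarrow> bool" where
  "bounded_selfadjoint S \<longleftrightarrow>
     bounded_linear S \<and> (\<forall>c u. S (c *\<^sub>C u) = c *\<^sub>C S u) \<and> selfadjoint_op (\<lambda>u. Some (S u))"

text \<open>For self-adjoint \<open>S\<close> the number \<open>cinner (S u) u\<close> is real, so \<open>Re\<close> only fixes the type.\<close>

definition strictly_positive :: "('h::chilbert_space \<Rightarrow> 'h) \<Rightarrow> bool" where
  "strictly_positive S \<longleftrightarrow> (\<exists>\<mu>>0. \<forall>u. Re (cinner (S u) u) \<ge> \<mu> * (norm u)\<^sup>2)"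

text \<open>The operator \<open>B + T\<close> on \<open>dom B\<close>, for \<open>T\<close> defined everywhere.\<close>

definition perturb :: "('h::chilbert_space \<rightharpoonup> 'h) \<Rightarrow> ('h \<Rightarrow> 'h) \<Rightarrow> ('h \<rightharpoonup> 'h)" where
  "perturb B T = (\<lambda>u. map_option (\<lambda>w. w + T u) (B u))"

definition op_ker :: "('h::chilbert_space \<rightharpoonup> 'h) \<Rightarrow> 'h set" where
  "op_ker B = {u. B u = Some 0}"

text \<open>
  The deficiency indices, computed at the points \<open>\<plusminus>\<i>\<beta>\<close>.  They do not depend on \<open>\<beta> > 0\<close>; rather
  than selecting one value, \<open>\<beta>\<close> is kept as a parameter.
\<close>

definition deficiency_plus :: "real \<Rightarrow> ('h::chilbert_space \<rightharpoonup> 'h) \<Rightarrow> 'h rel" where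
  "deficiency_plus \<beta> A =
     hilbert_dim (op_ker (perturb (adjoint_op A) (\<lambda>u. - ((\<i> * complex_of_real \<beta>) *\<^sub>C u))))"

definition deficiency_minus :: "real \<Rightarrow> ('h::chilbert_space \<rightharpoonup> 'h) \<Rightarrow> 'h rel" where
  "deficiency_minus \<beta> A =
     hilbert_dim (op_ker (perturb (adjoint_op A) (\<lambda>u. (\<i> * complex_of_real \<beta>) *\<^sub>C u)))"

definition ker_plus ::
  "('h::chilbert_space \<rightharpoonup> 'h) \<Rightarrow> ('h \<Rightarrow> 'h) \<Rightarrow> ('h \<Rightarrow> 'h) \<Rightarrow> 'h set" where
  "ker_plus A S\<^sub>1 S\<^sub>2 = op_ker (perturb (adjoint_op A) (\<lambda>u. - S\<^sub>1 u - \<i> *\<^sub>C S\<^sub>2 u))"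

definition ker_minus ::
  "('h::chilbert_space \<rightharpoonup> 'h) \<Rightarrow> ('h \<Rightarrow> 'h) \<Rightarrow> ('h \<Rightarrow> 'h) \<Rightarrow> 'h set" where
  "ker_minus A S\<^sub>1 S\<^sub>2 = op_ker (perturb (adjoint_op A) (\<lambda>u. - S\<^sub>1 u + \<i> *\<^sub>C S\<^sub>2 u))"

text \<open>The indefinite inner product \<open>[u | v]\<^sub>A\<close>; meaningful for \<open>u\<close>, \<open>v\<close> in \<open>dom (adjoint_op A)\<close>.\<close>

definition boundary_form :: "('h::chilbert_space \<rightharpoonup> 'h) \<Rightarrow> 'h \<Rightarrow> 'h \<Rightarrow> complex" where
  "boundary_form A u v =
     \<i> * (cinner (the (adjoint_op A u)) v - cinner u (the (adjoint_op A v)))"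

definition form_orthogonal :: "('h \<Rightarrow> 'h \<Rightarrow> complex) \<Rightarrow> 'h set \<Rightarrow> 'h set \<Rightarrow> bool" where
  "form_orthogonal f X Y \<longleftrightarrow> (\<forall>x\<in>X. \<forall>y\<in>Y. f x y = 0)"

definition direct_sum3 :: "'h::ab_group_add set \<Rightarrow> 'h set \<Rightarrow> 'h set \<Rightarrow> 'h set \<Rightarrow> bool" where
  "direct_sum3 D X Y Z \<longleftrightarrow>
     D = {x + y + z | x y z. x \<in> X \<and> y \<in> Y \<and> z \<in> Z} \<and>
     (\<forall>x\<in>X. \<forall>y\<in>Y. \<forall>z\<in>Z. \<forall>x'\<in>X. \<forall>y'\<in>Y. \<forall>z'\<in>Z.
        x + y + z = x' + y' + z' \<longrightarrow> x = x' \<and> y = y' \<and> z = z')"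

text \<open>
  Unitary transformations: linear surjective isometries from \<open>V\<close> with inner product \<open>f\<close> onto
  \<open>W\<close> with inner product \<open>g\<close>, an isometry being a map that preserves the norm.  They are partial
  maps with domain \<open>V\<close>, so that distinct partial maps are distinct transformations.
\<close>

definition form_norm :: "('h \<Rightarrow> 'h \<Rightarrow> complex) \<Rightarrow> 'h \<Rightarrow> real" where
  "form_norm f u = sqrt (Re (f u u))"

definition unitary_map ::
  "'h::chilbert_space set \<Rightarrow> ('h \<Rightarrow> 'h \<Rightarrow> complex) \<Rightarrow> 'h set \<Rightarrow> ('h \<Rightarrow> 'h \<Rightarrow> complex)
     \<Rightarrow> ('h \<rightharpoonup> 'h) \<Rightarrow> bool" where
  "unitary_map V f W g U \<longleftrightarrow>
     linear_op U \<and> dom U = V \<and> ran U = W \<and> (\<forall>\<nu>\<in>V. form_norm g (the (U \<nu>)) = form_norm f \<nu>)"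

definition full_unitaries ::
  "('h::chilbert_space \<rightharpoonup> 'h) \<Rightarrow> ('h \<Rightarrow> 'h) \<Rightarrow> ('h \<Rightarrow> 'h) \<Rightarrow> ('h \<rightharpoonup> 'h) set" where
  "full_unitaries A S\<^sub>1 S\<^sub>2 =
     {U. unitary_map (ker_minus A S\<^sub>1 S\<^sub>2) (boundary_form A)
           (ker_plus A S\<^sub>1 S\<^sub>2) (\<lambda>u v. - boundary_form A u v) U}"

text \<open>
  On the two kernels the norms given by \<open>boundary_form A\<close> resp. its negative are equivalent to
  the norm of the Hilbert space, and the kernels are closed.  So the closed subspaces of the
  kernels are the closed subspaces of the whole space that they contain.
\<close>

definition partial_unitaries ::
  "('h::chilbert_space \<rightharpoonup> 'h) \<Rightarrow> ('h \<Rightarrow> 'h) \<Rightarrow> ('h \<Rightarrow> 'h) \<Rightarrow> ('h \<rightharpoonup> 'h) set" where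
  "partial_unitaries A S\<^sub>1 S\<^sub>2 =
     {U. \<exists>V W. csubspace V \<and> closed V \<and> V \<subseteq> ker_minus A S\<^sub>1 S\<^sub>2 \<and>
               csubspace W \<and> closed W \<and> W \<subseteq> ker_plus A S\<^sub>1 S\<^sub>2 \<and>
               unitary_map V (boundary_form A) W (\<lambda>u v. - boundary_form A u v) U}"

definition extension_dom :: "('h::chilbert_space \<rightharpoonup> 'h) \<Rightarrow> ('h \<rightharpoonup> 'h) \<Rightarrow> 'h set" where
  "extension_dom A U =
     {u\<^sub>0 + the (U \<nu>) + \<nu> | u\<^sub>0 \<nu>. u\<^sub>0 \<in> dom (closure_op A) \<and> \<nu> \<in> dom U}"

definition extension :: "('h::chilbert_space \<rightharpoonup> 'h) \<Rightarrow> ('h \<rightharpoonup> 'h) \<Rightarrow> ('h \<rightharpoonup> 'h)" where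
  "extension A U = adjoint_op A |` extension_dom A U"

end

theory Submission
  imports Defs
begin

text \<open>
  The boundary form vanishes on \<open>dom (closure_op A)\<close>, is negative definite on
  \<open>N\<^sub>+ = ker_plus A S\<^sub>1 S\<^sub>2\<close>, where it equals \<open>- 2 \<langle>S\<^sub>2 u | v\<rangle>\<close>, and positive definite on
  \<open>N\<^sub>- = ker_minus A S\<^sub>1 S\<^sub>2\<close>, where it equals \<open>2 \<langle>S\<^sub>2 u | v\<rangle>\<close>; the three spaces are orthogonal.
  That they span \<open>dom (adjoint_op A)\<close> follows because the closure of \<open>A - S\<^sub>1 + \<i> S\<^sub>2\<close> is
  bounded below, so its range is the orthogonal complement of \<open>N\<^sub>+\<close>, and the whole space is the
  sum of this range and \<open>S\<^sub>2 N\<^sub>+\<close> (minimise the energy of \<open>S\<^sub>2\<close> on \<open>N\<^sub>+\<close>).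

  For the deficiency indices, decompose \<open>N\<^sub>+\<close> along the spaces belonging to \<open>(0, \<beta>)\<close>: by the signs
  of the form, the component in \<open>ker (adjoint_op A - \<i> \<beta>)\<close> controls the whole vector, which bounds
  the cardinality of an orthonormal basis; then exchange the roles and apply
  Schroeder-Bernstein.

  A symmetric realisation is a subspace between the two domains on which the form vanishes.
  Modulo \<open>dom (closure_op A)\<close> it is the graph of an isometry from \<open>N\<^sub>-\<close> to \<open>N\<^sub>+\<close>; it is closed
  exactly when this isometry is, and self-adjoint exactly when it equals its own orthogonal
  complement, that is, when the isometry is everywhere defined and onto.
\<close>

section \<open>Complex Hilbert spaces\<close>

lemma cinner_add_right: "cinner x (y + z) = cinner x y + cinner (x::'h::chilbert_space) z"
  by (metis cinner_commute cinner_add_left complex_cnj_add)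

lemma cinner_scaleC_right: "cinner x (c *\<^sub>C y) = cnj c * cinner (x::'h::chilbert_space) y"
  by (metis cinner_commute cinner_scaleC_left complex_cnj_mult)

lemma cinner_scaleR_left: "cinner (r *\<^sub>R x) y = r *\<^sub>R cinner (x::'h::chilbert_space) y"
  by (metis cinner_scaleC_left scaleC_of_real scaleR_conv_of_real)

lemma cinner_scaleR_right: "cinner x (r *\<^sub>R y) = r *\<^sub>R cinner (x::'h::chilbert_space) y"
  by (metis cinner_scaleC_right scaleC_of_real scaleR_conv_of_real complex_cnj_complex_of_real)

lemma norm_scaleC: "norm (c *\<^sub>C x) = cmod c * norm (x::'h::chilbert_space)"
proof -
  have "complex_of_real ((norm (c *\<^sub>C x))\<^sup>2) = (c * cnj c) * complex_of_real ((norm x)\<^sup>2)"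
    unfolding cinner_self[symmetric] cinner_scaleC_left cinner_scaleC_right by (simp add: mult_ac)
  also have "\<dots> = complex_of_real ((cmod c * norm x)\<^sup>2)"
    by (simp only: complex_norm_square[symmetric] of_real_mult power_mult_distrib)
  finally have "complex_of_real ((norm (c *\<^sub>C x))\<^sup>2) = complex_of_real ((cmod c * norm x)\<^sup>2)" .
  then show ?thesis
    by (metis norm_ge_zero of_real_eq_iff power2_eq_imp_eq mult_nonneg_nonneg)
qed

lemma cinner_eq_zero_iff: "cinner x x = 0 \<longleftrightarrow> x = (0::'h::chilbert_space)"
  by (simp add: cinner_self)

lemma cinner_cauchy_schwarz: "cmod (cinner x y) \<le> norm x * norm (y::'h::chilbert_space)"
proof (cases "y = 0")
  case True
  have "cinner x 0 = 0"
    using cinner_scaleC_right[of x 0 0] by simp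
  then show ?thesis using True by simp
next
  case False
  define c where "c = cinner x y"
  define a where "a = (norm y)\<^sup>2"
  \<comment> \<open>\<open>z\<close> is \<open>a\<close> times the component of \<open>x\<close>
    orthogonal to \<open>y\<close>; the scaling avoids a division.\<close>
  define z where "z = complex_of_real a *\<^sub>C x + (- c) *\<^sub>C y"
  have yx: "cinner y x = cnj c"
    unfolding c_def by (rule cinner_commute)
  have "cinner z z = of_real (a * (a * (norm x)\<^sup>2 - (cmod c)\<^sup>2))"
    unfolding z_def cinner_add_left cinner_add_right cinner_scaleC_left cinner_scaleC_right yx
      c_def[symmetric]
    unfolding cinner_self a_def[symmetric] of_real_mult of_real_diff complex_norm_square[of c]
    by (simp add: algebra_simps)
  then have "0 \<le> a * (a * (norm x)\<^sup>2 - (cmod c)\<^sup>2)"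
    by (metis cinner_self of_real_eq_iff zero_le_power2)
  then have "(cmod c)\<^sup>2 \<le> (norm x * norm y)\<^sup>2"
    using False by (simp add: a_def zero_le_mult_iff power_mult_distrib mult.commute)
  then show ?thesis
    unfolding c_def by (simp add: abs_le_square_iff)
qed

text \<open>Anti-linearity in the second entry is still linearity over the reals, so limits,
  continuity and sums of scalar products follow from the theory of real bounded bilinear
  maps.\<close>

interpretation cinner: bounded_bilinear "cinner :: 'h::chilbert_space \<Rightarrow> 'h \<Rightarrow> complex"
  by unfold_locales
    (auto simp: cinner_add_left cinner_add_right cinner_scaleR_left cinner_scaleR_right
      intro!: exI[of _ 1] cinner_cauchy_schwarz)

declare cinner.zero_left [simp] cinner.zero_right [simp]

lemma scaleC_scaleR_commute: "c *\<^sub>C (r *\<^sub>R x) = r *\<^sub>R (c *\<^sub>C (x::'h::chilbert_space))"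
  by (metis scaleC_of_real scaleC_scaleC mult.commute)

interpretation scaleC: bounded_bilinear "scaleC :: complex \<Rightarrow> 'h::chilbert_space \<Rightarrow> 'h"
proof
  fix r :: real and c :: complex and x :: 'h
  show "(r *\<^sub>R c) *\<^sub>C x = r *\<^sub>R c *\<^sub>C x"
    by (metis scaleC_of_real scaleC_scaleC scaleR_conv_of_real)
  show "\<exists>K. \<forall>a b. norm (a *\<^sub>C (b::'h)) \<le> norm a * norm b * K"
    by (intro exI[of _ 1]) (simp add: norm_scaleC)
qed (simp_all add: scaleC_add_left scaleC_add_right scaleC_scaleR_commute)

lemmas cinner_simps = cinner_add_left cinner_add_right cinner.diff_left cinner.diff_right
  cinner.minus_left cinner.minus_right cinner_scaleC_left cinner_scaleC_right

lemma Re_cinner_self: "Re (cinner x x) = (norm (x::'h::chilbert_space))\<^sup>2"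
  by (simp add: cinner_self)

text \<open>Gives basis vectors a uniform mutual distance, which turns norm bounds into injections
  when cardinalities of bases are compared.\<close>

lemma norm_diff_orthonormal:
  fixes x y :: "'h::chilbert_space"
  assumes "norm x = 1" "norm y = 1" "cinner x y = 0"
  shows "norm (x - y) = sqrt 2"
proof -
  have "cinner y x = 0"
    using assms(3) by (metis cinner_commute complex_cnj_zero)
  then have "complex_of_real ((norm (x - y))\<^sup>2) = of_real 2"
    using assms unfolding cinner_self[symmetric] cinner_simps
    by (simp add: cinner_self)
  then have "(norm (x - y))\<^sup>2 = 2"
    using of_real_eq_iff by blast
  then show ?thesis
    by (metis norm_ge_zero real_sqrt_unique)
qed

lemma csubspace_closure:
  fixes S :: "'h::chilbert_space set"
  assumes "csubspace S"
  shows "csubspace (closure S)"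
  unfolding complex_vector.subspace_def
proof (intro conjI ballI allI)
  show "0 \<in> closure S"
    using complex_vector.subspace_0[OF assms] closure_subset by blast
next
  fix x y assume "x \<in> closure S" "y \<in> closure S"
  then obtain f g where fg: "\<And>n. f n \<in> S" "f \<longlonglongrightarrow> x" "\<And>n. g n \<in> S" "g \<longlonglongrightarrow> y"
    unfolding closure_sequential by blast
  then have "(\<lambda>n. f n + g n) \<longlonglongrightarrow> x + y" "\<And>n. f n + g n \<in> S"
    by (auto intro: tendsto_add complex_vector.subspace_add[OF assms])
  then show "x + y \<in> closure S"
    unfolding closure_sequential by (intro exI[of _ "\<lambda>n. f n + g n"]) simp
next
  fix c x assume "x \<in> closure S"
  then obtain f where f: "\<And>n. f n \<in> S" "f \<longlonglongrightarrow> x"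
    unfolding closure_sequential by blast
  then have "(\<lambda>n. c *\<^sub>C f n) \<longlonglongrightarrow> c *\<^sub>C x" "\<And>n. c *\<^sub>C f n \<in> S"
    by (auto intro: scaleC.tendsto complex_vector.subspace_scale[OF assms])
  then show "c *\<^sub>C x \<in> closure S"
    unfolding closure_sequential by (intro exI[of _ "\<lambda>n. c *\<^sub>C f n"]) simp
qed

text \<open>Direct method: a minimising sequence of the energy \<open>J\<close> on \<open>M\<close>
  is Cauchy by coercivity, and stationarity at the minimum is the required identity. With the
  identity for \<open>S\<close> it yields orthogonal projections; with \<open>S2\<close> it yields
  the decomposition of \<open>D\<close> and the surjectivity of the self-adjoint
  correspondence.\<close>

lemma coercive_representation:
  fixes S :: "'h::chilbert_space \<Rightarrow> 'h" and M :: "'h set"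
  assumes M: "csubspace M" "closed M"
    and S: "bounded_linear S" "\<And>c u. S (c *\<^sub>C u) = c *\<^sub>C S u"
      "\<And>u v. cinner (S u) v = cinner u (S v)"
    and "\<mu> > 0" and \<mu>: "\<And>u. Re (cinner (S u) u) \<ge> \<mu> * (norm u)\<^sup>2"
  obtains n where "n \<in> M" "\<And>m. m \<in> M \<Longrightarrow> cinner (S n) m = cinner h m"
proof -
  interpret S: bounded_linear S by fact
  define J where "J n = Re (cinner (S n) n) - 2 * Re (cinner h n)" for n
  have J_ge: "J n \<ge> - ((norm h)\<^sup>2 / \<mu>)" for n
  proof -
    have "Re (cinner h n) \<le> norm h * norm n"
      using cinner_cauchy_schwarz[of h n] complex_Re_le_cmod order_trans by blast
    \<comment> \<open>Completing the square with weight \<open>sqrt \<mu>\<close> absorbs the linear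
      term of \<open>J\<close> into the coercive one.\<close>
    moreover have "0 \<le> (norm h / sqrt \<mu> - sqrt \<mu> * norm n)\<^sup>2" by simp
    then have "2 * (norm h * norm n) \<le> (norm h)\<^sup>2 / \<mu> + \<mu> * (norm n)\<^sup>2"
      using \<open>\<mu> > 0\<close> by (simp add: power2_diff power_divide power_mult_distrib)
    ultimately show ?thesis
      using \<mu>[of n] unfolding J_def by linarith
  qed
  define d where "d = Inf (J ` M)"
  have bdd: "bdd_below (J ` M)"
    using J_ge by (intro bdd_belowI2)
  have "M \<noteq> {}"
    using complex_vector.subspace_0[OF M(1)] by blast
  have d_le: "d \<le> J m" if "m \<in> M" for m
    unfolding d_def using bdd that by (rule cINF_lower)
  have "\<exists>n\<in>M. J n < d + inverse (real (Suc k))" for k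
    using cInf_lessD[of "J ` M" "d + inverse (real (Suc k))"] \<open>M \<noteq> {}\<close> unfolding d_def by auto
  then obtain s where s: "\<And>k. s k \<in> M" "\<And>k. J (s k) < d + inverse (real (Suc k))"
    by metis
  \<comment> \<open>The linear terms cancel in this combination. Since midpoints stay in
    \<open>M\<close>, nearly minimal points must be close to each other.\<close>
  have parallelogram: "J x + J y - 2 * J ((1/2) *\<^sub>R (x + y)) = Re (cinner (S (x - y)) (x - y)) / 2" for x y
  proof -
    have "Re (cinner (S y) x) = Re (cinner (S x) y)"
      unfolding S(3)[of y x] by (subst cinner_commute) simp
    then show ?thesis
      unfolding J_def S.diff S.add S.scaleR cinner_simps cinner_scaleR_left cinner_scaleR_right
      by (simp add: field_simps)
  qed
  have close: "\<mu> / 2 * (norm (s k - s l))\<^sup>2 \<le> inverse (real (Suc k)) + inverse (real (Suc l))" for k l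
  proof -
    have "(1/2) *\<^sub>R (s k + s l) \<in> M"
      unfolding scaleC_of_real[symmetric]
      using s(1) M(1) by (blast intro: complex_vector.subspace_scale complex_vector.subspace_add)
    from d_le[OF this] parallelogram[of "s k" "s l"] s(2)[of k] s(2)[of l] \<mu>[of "s k - s l"]
    show ?thesis by linarith
  qed
  have "Cauchy s"
  proof (rule metric_CauchyI)
    fix e :: real assume "e > 0"
    then have "\<mu> / 2 * e\<^sup>2 / 2 > 0" using \<open>\<mu> > 0\<close> by simp
    then obtain N where N: "inverse (real (Suc N)) < \<mu> / 2 * e\<^sup>2 / 2"
      using reals_Archimedean by blast
    have "dist (s k) (s l) < e" if "k \<ge> N" "l \<ge> N" for k l
    proof -
      have "inverse (real (Suc k)) \<le> inverse (real (Suc N))"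
        "inverse (real (Suc l)) \<le> inverse (real (Suc N))"
        using that by (simp_all add: field_simps)
      with close[of k l] N have "\<mu> / 2 * (norm (s k - s l))\<^sup>2 < \<mu> / 2 * e\<^sup>2" by linarith
      then have "(norm (s k - s l))\<^sup>2 < e\<^sup>2" using \<open>\<mu> > 0\<close> by simp
      then show ?thesis
        using \<open>e > 0\<close> by (simp add: dist_norm power2_less_imp_less)
    qed
    then show "\<exists>M. \<forall>m\<ge>M. \<forall>n\<ge>M. dist (s m) (s n) < e" by blast
  qed
  then obtain n where lim: "s \<longlonglongrightarrow> n"
    using Cauchy_convergent convergent_def by blast
  have "n \<in> M"
    using closed_sequentially[OF M(2) s(1) lim] .
  have "(\<lambda>k. J (s k)) \<longlonglongrightarrow> J n"
    unfolding J_def by (intro tendsto_intros cinner.tendsto S.tendsto lim)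
  moreover have "(\<lambda>k. d + inverse (real (Suc k))) \<longlonglongrightarrow> d + 0"
    by (intro tendsto_intros LIMSEQ_inverse_real_of_nat)
  ultimately have "J n \<le> d"
    using LIMSEQ_le[of "\<lambda>k. J (s k)" "J n" "\<lambda>k. d + inverse (real (Suc k))"] s(2)
    by (metis add.right_neutral less_imp_le)
  show thesis
  proof (rule that[OF \<open>n \<in> M\<close>])
    fix m assume "m \<in> M"
    define z where "z = cinner (S n) m - cinner h m"
    define a where "a = Re (cinner (S m) m)"
    \<comment> \<open>The minimiser is moved in direction \<open>m\<close> by the complex factor
      \<open>- (e *\<^sub>R z)\<close>. This phase makes the first-order term a negative multiple of
      \<open>(cmod z)\<^sup>2\<close>, so real and imaginary parts of \<open>z\<close> are treated
      at once.\<close>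
    have ineq: "0 \<le> e * (cmod z)\<^sup>2 * (e * a - 2)" for e :: real
    proof -
      let ?t = "- (e *\<^sub>R z)"
      have "n + ?t *\<^sub>C m \<in> M"
        using \<open>n \<in> M\<close> \<open>m \<in> M\<close> M(1)
        by (blast intro: complex_vector.subspace_scale complex_vector.subspace_add)
      then have "0 \<le> J (n + ?t *\<^sub>C m) - J n"
        using d_le \<open>J n \<le> d\<close> by force
      also have "cinner (S m) n = cnj (cinner (S n) m)"
        by (metis S(3) cinner_commute)
      then have "J (n + ?t *\<^sub>C m) - J n
        = Re (?t * cnj (cinner (S n) m) + cnj ?t * cinner (S n) m - 2 * (cnj ?t * cinner h m)
            + ?t * cnj ?t * cinner (S m) m)"
        unfolding J_def S.add S(2) cinner_simps by (simp add: algebra_simps)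
      also have "\<dots> = Re (2 * (cnj ?t * z) + ?t * cnj ?t * cinner (S m) m)"
        unfolding z_def by (simp add: algebra_simps)
      also have "\<dots> = e * (cmod z)\<^sup>2 * (e * a - 2)"
        unfolding a_def cmod_power2
        by (simp add: algebra_simps power2_eq_square)
      finally show ?thesis .
    qed
    have "z = 0"
    proof (rule ccontr)
      assume "z \<noteq> 0"
      \<comment> \<open>Small enough that the quadratic term cannot outweigh the linear one:
        \<open>e * a \<le> 1\<close>.\<close>
      define e where "e = 1 / (\<bar>a\<bar> + 1)"
      have "e > 0" and "e * a \<le> 1"
        unfolding e_def by (auto simp: field_simps)
      then have "e * (cmod z)\<^sup>2 * (e * a - 2) < 0"
        using \<open>z \<noteq> 0\<close> by (intro mult_pos_neg mult_pos_pos) auto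
      with ineq[of e] show False by linarith
    qed
    then show "cinner (S n) m = cinner h m"
      unfolding z_def by simp
  qed
qed

text \<open>Minimising the energy of the identity, with coercivity constant 1, is nearest-point
  projection.\<close>

lemma orthogonal_decomposition:
  fixes M :: "'h::chilbert_space set"
  assumes "csubspace M" "closed M"
  obtains n where "n \<in> M" "\<And>m. m \<in> M \<Longrightarrow> cinner (x - n) m = 0"
proof (rule coercive_representation[OF assms, of "\<lambda>u. u" 1 x])
  fix n assume "n \<in> M" "\<And>m. m \<in> M \<Longrightarrow> cinner n m = cinner x m"
  then show thesis
    by (intro that[of n]) (auto simp: cinner_simps)
qed (simp_all add: bounded_linear_ident Re_cinner_self)

section \<open>Hilbert space dimension\<close>

unbundle cardinal_syntax

text \<open>Zorn's lemma gives a maximal orthonormal subset of \<open>M\<close>. If its closed span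
  missed a vector of \<open>M\<close>, the normalised residual of that vector after projection could
  be added to the set.\<close>

lemma orthonormal_basis_exists:
  fixes M :: "'h::chilbert_space set"
  assumes M: "csubspace M" "closed M"
  shows "\<exists>B. orthonormal_basis M B"
proof -
  define ons where "ons = {B. B \<subseteq> M \<and> (\<forall>x\<in>B. norm x = 1) \<and> (\<forall>x\<in>B. \<forall>y\<in>B. x \<noteq> y \<longrightarrow> cinner x y = 0)}"
  have "\<exists>B\<in>ons. \<forall>X\<in>ons. B \<subseteq> X \<longrightarrow> X = B"
  proof (rule subset_Zorn_nonempty)
    show "ons \<noteq> {}"
      unfolding ons_def by blast
    fix C assume "C \<noteq> {}" and chain: "subset.chain ons C"
    have sub: "C \<subseteq> ons" and tot: "\<And>X Y. X \<in> C \<Longrightarrow> Y \<in> C \<Longrightarrow> X \<subseteq> Y \<or> Y \<subseteq> X"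
      using chain unfolding subset.chain_def by auto
    have orth: "cinner x y = 0" if "X \<in> C" "Y \<in> C" "x \<in> X" "y \<in> Y" "x \<noteq> y" for x y X Y
      using tot[OF that(1,2)] that sub unfolding ons_def by blast
    have "X \<subseteq> M" "\<forall>x\<in>X. norm x = 1" if "X \<in> C" for X
      using sub that unfolding ons_def by auto
    then have "\<Union>C \<subseteq> M" "\<forall>x\<in>\<Union>C. norm x = 1"
      by blast+
    moreover have "\<forall>x\<in>\<Union>C. \<forall>y\<in>\<Union>C. x \<noteq> y \<longrightarrow> cinner x y = 0"
      by (intro ballI impI, elim UnionE) (rule orth)
    ultimately show "\<Union>C \<in> ons"
      unfolding ons_def by (intro CollectI conjI)
  qed
  then obtain B where B: "B \<in> ons" and maximal: "\<And>X. X \<in> ons \<Longrightarrow> B \<subseteq> X \<Longrightarrow> X = B"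
    by blast
  let ?K = "closure (cspan B)"
  have K: "csubspace ?K"
    by (intro csubspace_closure complex_vector.subspace_span)
  have BM: "B \<subseteq> M" and Bn: "\<forall>x\<in>B. norm x = 1"
    and Bo: "\<forall>x\<in>B. \<forall>y\<in>B. x \<noteq> y \<longrightarrow> cinner x y = 0"
    using B unfolding ons_def by simp_all
  from BM have "?K \<subseteq> M"
    using M by (intro closure_minimal complex_vector.span_minimal)
  moreover have "x \<in> ?K" if "x \<in> M" for x
  proof -
    obtain n where n: "n \<in> ?K" "\<And>m. m \<in> ?K \<Longrightarrow> cinner (x - n) m = 0"
      using orthogonal_decomposition[OF K closed_closure] by blast
    have "x = n"
    proof (rule ccontr)
      assume "x \<noteq> n"
      define e where "e = complex_of_real (1 / norm (x - n)) *\<^sub>C (x - n)"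
      have perp: "cinner e b = 0" "cinner b e = 0" if "b \<in> B" for b
      proof -
        have "b \<in> ?K"
          using that closure_subset complex_vector.span_superset by blast
        then show "cinner e b = 0"
          unfolding e_def cinner_scaleC_left by (simp add: n(2))
        then show "cinner b e = 0"
          by (metis cinner_commute complex_cnj_zero)
      qed
      have "norm e = 1"
        using \<open>x \<noteq> n\<close> unfolding e_def by (simp add: norm_scaleC norm_divide)
      moreover have "e \<in> M"
        unfolding e_def using \<open>x \<in> M\<close> n(1) \<open>?K \<subseteq> M\<close> M(1)
        by (blast intro: complex_vector.subspace_scale complex_vector.subspace_diff)
      ultimately have "insert e B \<in> ons"
        using BM Bn Bo perp unfolding ons_def by simp
      then have "e \<in> B"
        using maximal by blast
      then show False
        using perp[of e] \<open>norm e = 1\<close> by (simp add: cinner_self)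
    qed
    then show ?thesis using n(1) by simp
  qed
  ultimately have "?K = M" by blast
  then show ?thesis
    unfolding orthonormal_basis_def using Bn Bo by (intro exI[of _ B] conjI)
qed

lemma hilbert_dim_basis:
  fixes M :: "'h::chilbert_space set"
  assumes "csubspace M" "closed M"
  obtains B where "orthonormal_basis M B" "hilbert_dim M = |B|"
  unfolding hilbert_dim_def using someI_ex[OF orthonormal_basis_exists[OF assms]] by blast

text \<open>The Fourier sum \<open>P\<close> is continuous, takes values in the span and fixes the
  span; hence it fixes the closure as well, and the span is already closed.\<close>

lemma finite_orthonormal_basis_span:
  fixes M :: "'h::chilbert_space set"
  assumes "orthonormal_basis M B" "finite B"
  shows "M = cspan B"
proof -
  have B: "\<And>x. x \<in> B \<Longrightarrow> norm x = 1" "\<And>x y. x \<in> B \<Longrightarrow> y \<in> B \<Longrightarrow> x \<noteq> y \<Longrightarrow> cinner x y = 0"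
    and M: "M = closure (cspan B)"
    using assms(1) unfolding orthonormal_basis_def by auto
  define P where "P x = (\<Sum>b\<in>B. cinner x b *\<^sub>C b)" for x
  have P_add: "P (c *\<^sub>C x + y) = c *\<^sub>C P x + P y" for c x y
    unfolding P_def
    by (simp add: cinner_simps scaleC_add_left sum.distrib complex_vector.scale_sum_right scaleC_scaleC)
  have P_basis: "P b = b" if "b \<in> B" for b
  proof -
    have "P b = (\<Sum>b'\<in>B. if b' = b then b else 0)"
      unfolding P_def using B(2)[OF that] B(1)[OF that]
      by (intro sum.cong) (auto simp: cinner_self)
    then show ?thesis using that \<open>finite B\<close> by simp
  qed
  have "P x = x" if "x \<in> cspan B" for x
    using that
  proof (induction rule: complex_vector.span_induct_alt)
    case base
    then show ?case by (simp add: P_def)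
  qed (simp add: P_add P_basis)
  moreover have "continuous_on UNIV P"
    unfolding P_def by (intro continuous_intros cinner.continuous_on scaleC.continuous_on)
  then have "closed {x. P x = x}"
    by (intro closed_Collect_eq continuous_on_id)
  ultimately have "closure (cspan B) \<subseteq> {x. P x = x}"
    by (intro closure_minimal) auto
  moreover have "P x \<in> cspan B" for x
    unfolding P_def by (intro complex_vector.span_sum complex_vector.span_scale complex_vector.span_base)
  ultimately have "closure (cspan B) \<subseteq> cspan B"
    by (metis (mono_tags, lifting) mem_Collect_eq subset_iff)
  then show ?thesis
    using closure_subset M by blast
qed

lemma orthonormal_sum_eq_zero:
  fixes B :: "'h::chilbert_space set"
  assumes "orthonormal_basis M B" "finite F" "F \<subseteq> B" "(\<Sum>b\<in>F. c b *\<^sub>C b) = 0" "b \<in> F"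
  shows "c b = 0"
proof -
  have "0 = cinner (\<Sum>b\<in>F. c b *\<^sub>C b) b"
    using assms(4) by simp
  also have "\<dots> = (\<Sum>b'\<in>F. if b' = b then c b else 0)"
    unfolding cinner.sum_left cinner_scaleC_left
    using assms(1,3,5) unfolding orthonormal_basis_def
    by (intro sum.cong) (auto simp: cinner_self)
  also have "\<dots> = c b" using assms(2,5) by simp
  finally show ?thesis by simp
qed

lemma countable_complex_dense:
  obtains Q :: "complex set" where "countable Q" "closure Q = UNIV"
proof -
  obtain Q :: "complex set" where "countable Q"
    "\<And>X. open X \<Longrightarrow> X \<noteq> {} \<Longrightarrow> \<exists>q\<in>Q. q \<in> X"
    using countable_dense_setE by blast
  then show thesis
    using that[of Q] closure_subset[of Q] open_Compl[OF closed_closure[of Q]] by blast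
qed

text \<open>Finite combinations with coefficients from a countable dense set \<open>Q\<close> are
  dense in \<open>M\<close>, and an infinite cardinal absorbs countable factors and countable
  unions.\<close>

lemma infinite_orthonormal_dense:
  fixes M :: "'h::chilbert_space set"
  assumes "orthonormal_basis M B" "infinite B"
  obtains D where "M \<subseteq> closure D" "|D| \<le>o |B|"
proof -
  obtain Q :: "complex set" where Q: "countable Q" "closure Q = UNIV"
    by (rule countable_complex_dense)
  have nat_le: "|UNIV :: nat set| \<le>o |B|"
    using \<open>infinite B\<close> infinite_iff_card_of_nat by blast
  have "|Q| \<le>o |UNIV :: nat set|"
    using Q(1) unfolding countable_def card_of_ordLeq[symmetric] by blast
  then have Q_le: "|Q| \<le>o |B|"
    using nat_le ordLeq_transitive by blast
  \<comment> \<open>One application adds one term \<open>q *\<^sub>C b\<close>; iteration from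
    \<open>{0}\<close> produces the finite combinations without any bookkeeping of supports.\<close>
  define step :: "'h set \<Rightarrow> 'h set" where
    "step E = (\<lambda>(q, b, x). q *\<^sub>C b + x) ` (Q \<times> B \<times> E)" for E
  define D where "D = (\<Union>n. (step ^^ n) {0})"
  have card_step: "|step E| \<le>o |B|" if "|E| \<le>o |B|" for E
  proof -
    have "|B \<times> E| \<le>o |B|"
      using \<open>infinite B\<close> that by (intro card_of_Sigma_ordLeq_infinite) (simp_all add: card_of_mono1)
    then have "|Q \<times> B \<times> E| \<le>o |B|"
      using \<open>infinite B\<close> Q_le by (intro card_of_Sigma_ordLeq_infinite) (simp_all add: card_of_mono1)
    then show ?thesis
      unfolding step_def using card_of_image ordLeq_transitive by blast
  qed
  have "|(step ^^ n) {0}| \<le>o |B|" for n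
  proof (induction n)
    case 0
    have "B \<noteq> {}" using \<open>infinite B\<close> by auto
    then show ?case by (simp add: card_of_singl_ordLeq)
  qed (simp add: card_step)
  then have "|D| \<le>o |B|"
    unfolding D_def using \<open>infinite B\<close> nat_le by (intro card_of_UNION_ordLeq_infinite) auto
  have D_step: "q *\<^sub>C b + x \<in> D" if "q \<in> Q" "b \<in> B" "x \<in> D" for q b x
  proof -
    obtain n where "x \<in> (step ^^ n) {0}"
      using \<open>x \<in> D\<close> unfolding D_def by blast
    then have "q *\<^sub>C b + x \<in> (step ^^ Suc n) {0}"
      using that unfolding funpow.simps o_def step_def[of "(step ^^ n) {0}"] by force
    then show ?thesis unfolding D_def by blast
  qed
  have "x \<in> closure D" if "x \<in> cspan B" for x
    using that
  proof (induction rule: complex_vector.span_induct_alt)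
    case base
    have "0 \<in> (step ^^ 0) {0}" by simp
    then have "0 \<in> D" unfolding D_def by blast
    then show ?case using closure_subset by blast
  next
    case (step c b y)
    obtain f where f: "\<And>n. f n \<in> D" "f \<longlonglongrightarrow> y"
      using step(2) unfolding closure_sequential by blast
    have "c \<in> closure Q" using Q(2) by simp
    then obtain g where g: "\<And>n. g n \<in> Q" "g \<longlonglongrightarrow> c"
      unfolding closure_sequential by blast
    have "(\<lambda>n. g n *\<^sub>C b + f n) \<longlonglongrightarrow> c *\<^sub>C b + y"
      by (intro tendsto_add scaleC.tendsto f g tendsto_const)
    moreover have "\<And>n. g n *\<^sub>C b + f n \<in> D"
      using D_step f(1) g(1) step(1) by blast
    ultimately show ?case
      unfolding closure_sequential by (intro exI[of _ "\<lambda>n. g n *\<^sub>C b + f n"]) simp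
  qed
  then have "closure (cspan B) \<subseteq> closure D"
    by (intro closure_minimal) auto
  then show thesis
    using that \<open>|D| \<le>o |B|\<close> assms(1) unfolding orthonormal_basis_def by blast
qed

text \<open>\<open>R\<close> stands for a linear map from \<open>M\<close> to \<open>N\<close> that
  is bounded below; as a relation it needs no linear choice of values. If \<open>B'\<close> is
  finite, the images of \<open>B\<close> are independent in the span of \<open>B'\<close>. If
  \<open>B'\<close> is infinite, they are separated points, approximated injectively by a dense set
  of size at most that of \<open>B'\<close>.\<close>

lemma orthonormal_basis_card_le:
  fixes M N :: "'h::chilbert_space set"
  assumes B: "orthonormal_basis M B" and B': "orthonormal_basis N B'"
    and total: "\<And>u. u \<in> M \<Longrightarrow> \<exists>p\<in>N. R u p"
    and R_zero: "R 0 0"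
    and R_add: "\<And>u p v q. R u p \<Longrightarrow> R v q \<Longrightarrow> R (u + v) (p + q)"
    and R_scale: "\<And>c u p. R u p \<Longrightarrow> R (c *\<^sub>C u) (c *\<^sub>C p)"
    and below: "\<And>u p. R u p \<Longrightarrow> u \<in> M \<Longrightarrow> p \<in> N \<Longrightarrow> norm u \<le> C * norm p"
  shows "|B| \<le>o |B'|"
proof -
  have onb: "\<And>x. x \<in> B \<Longrightarrow> norm x = 1" "\<And>x y. x \<in> B \<Longrightarrow> y \<in> B \<Longrightarrow> x \<noteq> y \<Longrightarrow> cinner x y = 0"
    and M: "M = closure (cspan B)" and N: "N = closure (cspan B')"
    using B B' unfolding orthonormal_basis_def by auto
  have sub: "csubspace M" "csubspace N"
    unfolding M N by (intro csubspace_closure complex_vector.subspace_span)+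
  have "B \<subseteq> M"
    unfolding M using closure_subset complex_vector.span_superset by blast
  then have "\<forall>b\<in>B. \<exists>p. p \<in> N \<and> R b p"
    using total by blast
  then obtain t where t: "\<And>b. b \<in> B \<Longrightarrow> t b \<in> N" "\<And>b. b \<in> B \<Longrightarrow> R b (t b)"
    by metis
  have sep: "sqrt 2 \<le> C * norm (t a - t b)" if "a \<in> B" "b \<in> B" "a \<noteq> b" for a b
  proof -
    have "R (a + (- 1) *\<^sub>C b) (t a + (- 1) *\<^sub>C t b)"
      using that t(2) by (intro R_add R_scale)
    then have "R (a - b) (t a - t b)" by simp
    then have "norm (a - b) \<le> C * norm (t a - t b)"
      using that t(1) \<open>B \<subseteq> M\<close> sub
      by (intro below) (auto intro: complex_vector.subspace_diff)
    then show ?thesis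
      using norm_diff_orthonormal[of a b] onb that by simp
  qed
  have inj: "inj_on t B"
  proof (rule inj_onI, rule ccontr)
    fix a b assume "a \<in> B" "b \<in> B" "t a = t b" "a \<noteq> b"
    then show False using sep[of a b] by simp
  qed
  show ?thesis
  proof (cases "finite B'")
    case True
    have "complex_vector.independent (t ` B)"
      unfolding complex_vector.independent_explicit_finite_subsets
    proof (intro allI impI ballI)
      fix F c v assume F: "F \<subseteq> t ` B" "finite F" "(\<Sum>v\<in>F. c v *\<^sub>C v) = 0" "v \<in> F"
      obtain G where G: "G \<subseteq> B" "F = t ` G"
        using F(1) by (meson subset_imageE)
      then have injG: "inj_on t G" using inj inj_on_subset by blast
      have fin: "finite G" using F(2) G(2) injG finite_image_iff by blast
      \<comment> \<open>A linear dependence among the images is lifted to \<open>M\<close> through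
        \<open>R\<close>; there \<open>below\<close> makes the combination vanish, and
        orthonormality kills its coefficients.\<close>
      have "R (\<Sum>b\<in>G'. c (t b) *\<^sub>C b) (\<Sum>b\<in>G'. c (t b) *\<^sub>C t b)" if "finite G'" "G' \<subseteq> B" for G'
        using that by (induction G' rule: finite_induct) (auto intro: R_zero R_add R_scale t(2))
      then have R: "R (\<Sum>b\<in>G. c (t b) *\<^sub>C b) 0"
        using F(3) G fin by (metis (no_types, lifting) sum.reindex_cong[OF injG])
      have "(\<Sum>b\<in>G. c (t b) *\<^sub>C b) \<in> M"
        using G(1) \<open>B \<subseteq> M\<close> sub(1)
        by (intro complex_vector.subspace_sum complex_vector.subspace_scale) auto
      from below[OF R this] have "(\<Sum>b\<in>G. c (t b) *\<^sub>C b) = 0"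
        using complex_vector.subspace_0[OF sub(2)] by simp
      moreover obtain b where "b \<in> G" "v = t b" using F(4) G(2) by blast
      ultimately show "c v = 0"
        using orthonormal_sum_eq_zero[OF B fin G(1), of "\<lambda>b. c (t b)" b] by blast
    qed
    moreover have "t ` B \<subseteq> cspan B'"
      using t(1) finite_orthonormal_basis_span[OF B' True] by blast
    ultimately have "finite (t ` B)" "card (t ` B) \<le> card B'"
      using complex_vector.independent_span_bound[OF True] by blast+
    then have "finite B" "card B \<le> card B'"
      using inj finite_image_iff card_image by (blast, metis)
    then show ?thesis
      using True card_le_inj[of B B'] card_of_ordLeq[of B B'] by blast
  next
    case False
    obtain D where D: "N \<subseteq> closure D" "|D| \<le>o |B'|"
      using infinite_orthonormal_dense[OF B' False] .
    \<comment> \<open>A positive constant above \<open>C\<close>, so that division by it is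
      possible.\<close>
    define C' where "C' = \<bar>C\<bar> + 1"
    have "C' > 0" unfolding C'_def by simp
    have sep': "sqrt 2 \<le> C' * norm (t a - t b)" if "a \<in> B" "b \<in> B" "a \<noteq> b" for a b
    proof -
      have "C \<le> C'" unfolding C'_def by linarith
      then show ?thesis
        using sep[OF that] mult_right_mono[of C C' "norm (t a - t b)"] by simp
    qed
    \<comment> \<open>The radius is half of the separation \<open>sqrt 2 / C'\<close>, so different
      basis vectors receive different approximants.\<close>
    have "\<exists>x\<in>D. dist x (t b) < sqrt 2 / (2 * C')" if "b \<in> B" for b
    proof -
      have "t b \<in> closure D" using t(1)[OF that] D(1) by blast
      moreover have "sqrt 2 / (2 * C') > 0" using \<open>C' > 0\<close> by simp
      ultimately show ?thesis unfolding closure_approachable by blast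
    qed
    then obtain s where s: "\<And>b. b \<in> B \<Longrightarrow> s b \<in> D" "\<And>b. b \<in> B \<Longrightarrow> dist (s b) (t b) < sqrt 2 / (2 * C')"
      by metis
    have "inj_on s B"
    proof (rule inj_onI, rule ccontr)
      fix a b assume ab: "a \<in> B" "b \<in> B" "s a = s b" "a \<noteq> b"
      have "norm (t a - t b) \<le> dist (s a) (t a) + dist (s b) (t b)"
        using ab(3) dist_triangle2[of "t a" "t b" "s a"] by (simp add: dist_norm norm_minus_commute)
      also have "\<dots> < sqrt 2 / C'"
        using s(2)[OF ab(1)] s(2)[OF ab(2)] by (simp add: field_simps)
      finally show False
        using sep'[OF ab(1,2,4)] \<open>C' > 0\<close> by (simp add: field_simps)
    qed
    then have "|B| \<le>o |D|"
      using s(1) card_of_ordLeq[of B D] by blast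
    then show ?thesis
      using D(2) ordLeq_transitive by blast
  qed
qed

section \<open>Adjoint, closure and boundary form\<close>

lemma op_of_graph_eq_Some_iff:
  assumes "\<And>u w w'. (u, w) \<in> G \<Longrightarrow> (u, w') \<in> G \<Longrightarrow> w = w'"
  shows "op_of_graph G u = Some w \<longleftrightarrow> (u, w) \<in> G"
proof
  assume *: "op_of_graph G u = Some w"
  then have "\<exists>!w. (u, w) \<in> G" and "(THE w. (u, w) \<in> G) = w"
    unfolding op_of_graph_def by (auto split: if_splits)
  then show "(u, w) \<in> G"
    by (metis theI')
next
  assume *: "(u, w) \<in> G"
  then have "\<exists>!w. (u, w) \<in> G"
    using assms by blast
  moreover from this * have "(THE w. (u, w) \<in> G) = w"
    by (intro the1_equality)
  ultimately show "op_of_graph G u = Some w"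
    unfolding op_of_graph_def by simp
qed

text \<open>Two candidate values differ by a vector orthogonal to the dense domain, hence they agree
  and the graph in the definition is single-valued.\<close>

lemma adjoint_op_eq_Some_iff:
  fixes B :: "'h::chilbert_space \<rightharpoonup> 'h"
  assumes "densely_defined B"
  shows "adjoint_op B v = Some w \<longleftrightarrow> (\<forall>u\<in>dom B. cinner (the (B u)) v = cinner u w)"
  unfolding adjoint_op_def
proof (subst op_of_graph_eq_Some_iff)
  fix u w w' assume "(u, w) \<in> {(v, w). \<forall>u\<in>dom B. cinner (the (B u)) v = cinner u w}"
    "(u, w') \<in> {(v, w). \<forall>u\<in>dom B. cinner (the (B u)) v = cinner u w}"
  then have "\<forall>x\<in>dom B. cinner x (w - w') = 0"
    by (simp add: cinner_simps)
  then have "dom B \<subseteq> {x. cinner x (w - w') = 0}" by blast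
  moreover have "closed {x. cinner x (w - w') = 0}"
    by (intro closed_Collect_eq cinner.continuous_on continuous_intros)
  ultimately have "closure (dom B) \<subseteq> {x. cinner x (w - w') = 0}"
    by (rule closure_minimal)
  then have "cinner (w - w') (w - w') = 0"
    using assms unfolding densely_defined_def by blast
  then show "w = w'"
    by (simp add: cinner_eq_zero_iff)
qed simp

lemma bounded_selfadjoint_cinner:
  assumes "bounded_selfadjoint S"
  shows "cinner (S u) v = cinner u (S v)"
proof -
  have "densely_defined (\<lambda>u. Some (S u))" "adjoint_op (\<lambda>u. Some (S u)) v = Some (S v)"
    using assms unfolding bounded_selfadjoint_def selfadjoint_op_def by auto
  then show ?thesis
    by (subst (asm) adjoint_op_eq_Some_iff) (auto simp: dom_def)
qed

locale symmetric_operator =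
  fixes A :: "'h::chilbert_space \<rightharpoonup> 'h"
  assumes linear: "linear_op A" and dense: "densely_defined A" and symmetric: "symmetric_op A"
begin

abbreviation D where "D \<equiv> dom (adjoint_op A)"
abbreviation As where "As u \<equiv> the (adjoint_op A u)"
abbreviation D0 where "D0 \<equiv> dom (closure_op A)"
abbreviation bf where "bf \<equiv> boundary_form A"

lemma dom_subspace: "csubspace (dom A)"
  using linear unfolding linear_op_def by blast

lemma adj_eqI:
  assumes "\<And>u. u \<in> dom A \<Longrightarrow> cinner (the (A u)) v = cinner u w"
  shows "v \<in> D" "As v = w"
proof -
  have "adjoint_op A v = Some w"
    using adjoint_op_eq_Some_iff[OF dense] assms by blast
  then show "v \<in> D" "As v = w" by (auto simp: domI)
qed

lemma adj_cinner:
  assumes "u \<in> dom A" "v \<in> D"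
  shows "cinner (the (A u)) v = cinner u (As v)"
proof -
  have "adjoint_op A v = Some (As v)" using assms(2) by auto
  then show ?thesis using adjoint_op_eq_Some_iff[OF dense] assms by blast
qed

lemma adj_add:
  assumes "u \<in> D" "v \<in> D"
  shows "u + v \<in> D" "As (u + v) = As u + As v"
  using adj_eqI[of "u + v" "As u + As v"] assms by (auto simp: adj_cinner cinner_simps simp del: domIff)

lemma adj_scale:
  assumes "u \<in> D"
  shows "c *\<^sub>C u \<in> D" "As (c *\<^sub>C u) = c *\<^sub>C As u"
  using adj_eqI[of "c *\<^sub>C u" "c *\<^sub>C As u"] assms by (auto simp: adj_cinner cinner_simps simp del: domIff)

lemma adj_diff:
  assumes "u \<in> D" "v \<in> D"
  shows "u - v \<in> D" "As (u - v) = As u - As v"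
  using adj_eqI[of "u - v" "As u - As v"] assms by (auto simp: adj_cinner cinner_simps simp del: domIff)

lemma adj_zero: "0 \<in> D" "As 0 = 0"
  using adj_eqI[of 0 0] by auto

text \<open>Closedness of the adjoint: its defining identity against a fixed \<open>u\<close> in
  \<open>dom A\<close> passes to the limit.\<close>

lemma adj_closed:
  assumes "\<And>n. f n \<in> D" "f \<longlonglongrightarrow> x" "(\<lambda>n. As (f n)) \<longlonglongrightarrow> y"
  shows "x \<in> D" "As x = y"
proof -
  have "cinner (the (A u)) x = cinner u y" if "u \<in> dom A" for u
  proof (rule LIMSEQ_unique)
    show "(\<lambda>n. cinner (the (A u)) (f n)) \<longlonglongrightarrow> cinner (the (A u)) x"
      by (intro cinner.tendsto tendsto_const assms)
    show "(\<lambda>n. cinner (the (A u)) (f n)) \<longlonglongrightarrow> cinner u y"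
      unfolding adj_cinner[OF that assms(1)] by (intro cinner.tendsto tendsto_const assms)
  qed
  then show "x \<in> D" "As x = y" using adj_eqI by blast+
qed

lemma adj_extends: 
  assumes "u \<in> dom A"
  shows "u \<in> D" "As u = the (A u)"
proof -
  have "cinner (the (A v)) u = cinner v (the (A u))" if "v \<in> dom A" for v
    using symmetric assms that unfolding symmetric_op_def by blast
  then show "u \<in> D" "As u = the (A u)" using adj_eqI by blast+
qed

text \<open>Symmetry puts \<open>A\<close> below its adjoint, so the values along the sequence can
  be written with \<open>As\<close>. The closure can then be handled as a restriction of the
  adjoint.\<close>

lemma mem_closure_graph_iff:
  "(u, w) \<in> closure (Map.graph A) \<longleftrightarrow>
     (\<exists>f. (\<forall>n. f n \<in> dom A) \<and> f \<longlonglongrightarrow> u \<and> (\<lambda>n. As (f n)) \<longlonglongrightarrow> w)"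
proof
  assume "(u, w) \<in> closure (Map.graph A)"
  then obtain g where g: "\<And>n. g n \<in> Map.graph A" "g \<longlonglongrightarrow> (u, w)"
    unfolding closure_sequential by blast
  then have A_g: "A (fst (g n)) = Some (snd (g n))" for n
    by (metis in_graphD prod.collapse)
  have "(\<lambda>n. fst (g n)) \<longlonglongrightarrow> u" "(\<lambda>n. snd (g n)) \<longlonglongrightarrow> w"
    using tendsto_fst[OF g(2)] tendsto_snd[OF g(2)] by simp_all
  moreover have "fst (g n) \<in> dom A" "As (fst (g n)) = snd (g n)" for n
    using A_g[of n] adj_extends(2)[of "fst (g n)"] by (auto simp: domI)
  ultimately show "\<exists>f. (\<forall>n. f n \<in> dom A) \<and> f \<longlonglongrightarrow> u \<and> (\<lambda>n. As (f n)) \<longlonglongrightarrow> w"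
    by (intro exI[of _ "\<lambda>n. fst (g n)"]) simp
next
  assume "\<exists>f. (\<forall>n. f n \<in> dom A) \<and> f \<longlonglongrightarrow> u \<and> (\<lambda>n. As (f n)) \<longlonglongrightarrow> w"
  then obtain f where f: "\<And>n. f n \<in> dom A" "f \<longlonglongrightarrow> u" "(\<lambda>n. As (f n)) \<longlonglongrightarrow> w"
    by blast
  have "A (f n) = Some (As (f n))" for n
    using f(1)[of n] adj_extends(2)[of "f n"] by auto
  then have "(f n, As (f n)) \<in> Map.graph A" for n
    by (rule in_graphI)
  then show "(u, w) \<in> closure (Map.graph A)"
    unfolding closure_sequential using tendsto_Pair[OF f(2,3)]
    by (intro exI[of _ "\<lambda>n. (f n, As (f n))"]) blast
qed

text \<open>Closability of \<open>A\<close>: the adjoint is a closed operator that extends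
  it.\<close>

lemma closure_graph_adj:
  assumes "(u, w) \<in> closure (Map.graph A)"
  shows "u \<in> D" "As u = w"
  using assms adj_closed adj_extends(1) unfolding mem_closure_graph_iff by metis+

lemma closure_op_eq_Some_iff: "closure_op A u = Some w \<longleftrightarrow> (u, w) \<in> closure (Map.graph A)"
  unfolding closure_op_def by (rule op_of_graph_eq_Some_iff) (metis closure_graph_adj(2))

lemma closure_op_adj:
  assumes "u \<in> D0"
  shows "u \<in> D" "the (closure_op A u) = As u"
proof -
  obtain w where w: "closure_op A u = Some w" using assms by blast
  then show "u \<in> D" "the (closure_op A u) = As u"
    using closure_graph_adj[of u w] closure_op_eq_Some_iff[of u w] w by simp_all
qed

lemma mem_D0_iff: "u \<in> D0 \<longleftrightarrow> u \<in> D \<and> (u, As u) \<in> closure (Map.graph A)"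
proof
  assume u: "u \<in> D0"
  then have "closure_op A u = Some (As u)"
    using closure_op_adj(2)[OF u] by auto
  then show "u \<in> D \<and> (u, As u) \<in> closure (Map.graph A)"
    using closure_op_adj(1)[OF u] closure_op_eq_Some_iff by blast
next
  assume "u \<in> D \<and> (u, As u) \<in> closure (Map.graph A)"
  then show "u \<in> D0"
    using closure_op_eq_Some_iff by blast
qed

lemma dom_subset_D0: "u \<in> dom A \<Longrightarrow> u \<in> D0"
  unfolding mem_D0_iff mem_closure_graph_iff using adj_extends(1)
  by (intro conjI exI[of _ "\<lambda>_. u"]) auto

lemma D0_closed:
  assumes "\<And>n. f n \<in> D0" "f \<longlonglongrightarrow> x" "(\<lambda>n. As (f n)) \<longlonglongrightarrow> y"
  shows "x \<in> D0" "As x = y"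
proof -
  have "\<And>n. (f n, As (f n)) \<in> closure (Map.graph A)"
    using assms(1) mem_D0_iff by blast
  then have "(x, y) \<in> closure (Map.graph A)"
    using closed_sequentially[OF closed_closure _ tendsto_Pair[OF assms(2,3)]] by blast
  then show "x \<in> D0" "As x = y"
    using closure_graph_adj mem_D0_iff by auto
qed

lemma D0_add:
  assumes "u \<in> D0" "v \<in> D0"
  shows "u + v \<in> D0"
proof -
  obtain f g where fg: "\<And>n. f n \<in> dom A" "f \<longlonglongrightarrow> u" "(\<lambda>n. As (f n)) \<longlonglongrightarrow> As u"
    "\<And>n. g n \<in> dom A" "g \<longlonglongrightarrow> v" "(\<lambda>n. As (g n)) \<longlonglongrightarrow> As v"
    using assms unfolding mem_D0_iff mem_closure_graph_iff by blast
  have dom: "f n + g n \<in> dom A" for n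
    using complex_vector.subspace_add[OF dom_subspace fg(1,4)] .
  have "As (f n + g n) = As (f n) + As (g n)" for n
    using fg adj_extends(1) adj_add(2) by blast
  then have "(\<lambda>n. As (f n + g n)) \<longlonglongrightarrow> As u + As v"
    by (simp add: tendsto_add fg)
  from D0_closed(1)[OF dom_subset_D0[OF dom] tendsto_add[OF fg(2,5)] this] show ?thesis .
qed

lemma D0_scale:
  assumes "u \<in> D0"
  shows "c *\<^sub>C u \<in> D0"
proof -
  obtain f where f: "\<And>n. f n \<in> dom A" "f \<longlonglongrightarrow> u" "(\<lambda>n. As (f n)) \<longlonglongrightarrow> As u"
    using assms unfolding mem_D0_iff mem_closure_graph_iff by blast
  have dom: "c *\<^sub>C f n \<in> dom A" for n
    using complex_vector.subspace_scale[OF dom_subspace f(1)] .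
  have "As (c *\<^sub>C f n) = c *\<^sub>C As (f n)" for n
    using f adj_extends(1) adj_scale(2) by blast
  then have "(\<lambda>n. As (c *\<^sub>C f n)) \<longlonglongrightarrow> c *\<^sub>C As u"
    by (simp add: scaleC.tendsto f)
  from D0_closed(1)[OF dom_subset_D0[OF dom] scaleC.tendsto[OF tendsto_const f(2)] this] show ?thesis .
qed

lemma D0_subspace: "csubspace D0"
  using dom_subset_D0[OF complex_vector.subspace_0[OF dom_subspace]]
  by (intro complex_vector.subspaceI D0_add D0_scale)

text \<open>Only \<open>u\<close> is approximated from \<open>dom A\<close>, where the identity is
  the definition of the adjoint. This is what makes the boundary form vanish between
  \<open>D0\<close> and \<open>D\<close>.\<close>

lemma closure_op_cinner:
  assumes "u \<in> D0" "v \<in> D"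
  shows "cinner (As u) v = cinner u (As v)"
proof -
  obtain f where f: "\<And>n. f n \<in> dom A" "f \<longlonglongrightarrow> u" "(\<lambda>n. As (f n)) \<longlonglongrightarrow> As u"
    using assms(1) unfolding mem_D0_iff mem_closure_graph_iff by blast
  show ?thesis
  proof (rule LIMSEQ_unique)
    show "(\<lambda>n. cinner (As (f n)) v) \<longlonglongrightarrow> cinner (As u) v"
      by (intro cinner.tendsto tendsto_const f)
    show "(\<lambda>n. cinner (As (f n)) v) \<longlonglongrightarrow> cinner u (As v)"
      unfolding adj_extends(2)[OF f(1)] adj_cinner[OF f(1) assms(2)]
      by (intro cinner.tendsto tendsto_const f)
  qed
qed

section \<open>The boundary form\<close>

lemma bf_add_left: "u \<in> D \<Longrightarrow> u' \<in> D \<Longrightarrow> bf (u + u') v = bf u v + bf u' v"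
  unfolding boundary_form_def by (simp add: adj_add cinner_simps algebra_simps)

lemma bf_diff_left: "u \<in> D \<Longrightarrow> u' \<in> D \<Longrightarrow> bf (u - u') v = bf u v - bf u' v"
  unfolding boundary_form_def by (simp add: adj_diff cinner_simps algebra_simps)

lemma bf_scale_left: "u \<in> D \<Longrightarrow> bf (c *\<^sub>C u) v = c * bf u v"
  unfolding boundary_form_def by (simp add: adj_scale cinner_simps algebra_simps)

lemma bf_commute: "bf u v = cnj (bf v u)"
  unfolding boundary_form_def complex_cnj_mult complex_cnj_diff
  by (subst (1 2) cinner_commute) (simp add: algebra_simps)

lemma bf_add_right: "v \<in> D \<Longrightarrow> v' \<in> D \<Longrightarrow> bf u (v + v') = bf u v + bf u v'"
  by (metis bf_add_left bf_commute complex_cnj_add)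

lemma bf_diff_right: "v \<in> D \<Longrightarrow> v' \<in> D \<Longrightarrow> bf u (v - v') = bf u v - bf u v'"
  by (metis bf_diff_left bf_commute complex_cnj_diff)

lemma bf_scale_right: "v \<in> D \<Longrightarrow> bf u (c *\<^sub>C v) = cnj c * bf u v"
  by (metis bf_scale_left bf_commute complex_cnj_mult)

lemma bf_D0_left: "u \<in> D0 \<Longrightarrow> v \<in> D \<Longrightarrow> bf u v = 0"
  unfolding boundary_form_def by (simp add: closure_op_cinner)

lemma bf_D0_right: "u \<in> D0 \<Longrightarrow> v \<in> D \<Longrightarrow> bf v u = 0"
  by (metis bf_D0_left bf_commute complex_cnj_zero)

lemma bf_eq_0_iff: "bf u v = 0 \<longleftrightarrow> cinner (As u) v = cinner u (As v)"
  unfolding boundary_form_def by simp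

lemma bf_Im_self: "Im (bf u u) = 0"
  using bf_commute[of u u] by (metis Im_complex_of_real Reals_cnj_iff Reals_cases)

text \<open>Continuity of the form in the graph norm; it supplies the upper bounds in the component
  estimates.\<close>

lemma bf_bound: "cmod (bf u v) \<le> norm (As u) * norm v + norm u * norm (As v)"
  unfolding boundary_form_def norm_mult
  using norm_triangle_ineq4[of "cinner (As u) v" "cinner u (As v)"]
    cinner_cauchy_schwarz[of "As u" v] cinner_cauchy_schwarz[of u "As v"] by simp

text \<open>Polarisation: testing with \<open>x + y\<close> and \<open>x + \<i> *\<^sub>C y\<close>
  gives two independent linear relations between \<open>bf x y\<close> and
  \<open>bf y x\<close>.\<close>

lemma bf_vanishes_on_subspace:
  assumes "csubspace X" "X \<subseteq> D" "\<And>x. x \<in> X \<Longrightarrow> bf x x = 0" "x \<in> X" "y \<in> X"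
  shows "bf x y = 0"
proof -
  have D: "x \<in> D" "y \<in> D" "\<i> *\<^sub>C y \<in> D" using assms(2,4,5) adj_scale(1) by blast+
  have "x + y \<in> X" "x + \<i> *\<^sub>C y \<in> X"
    using assms(1,4,5) by (auto intro: complex_vector.subspace_add complex_vector.subspace_scale)
  then have "bf (x + y) (x + y) = 0" "bf (x + \<i> *\<^sub>C y) (x + \<i> *\<^sub>C y) = 0"
    using assms(3) by blast+
  then have "bf x y + bf y x = 0" "- \<i> * bf x y + \<i> * bf y x = 0"
    using D assms(3)[OF assms(4)] assms(3)[OF assms(5)]
    by (simp_all add: bf_add_left bf_add_right bf_scale_left bf_scale_right adj_add del: domIff)
  then have "\<i> * (bf x y + bf y x) - (- \<i> * bf x y + \<i> * bf y x) = 0" by simp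
  then show ?thesis by (simp add: algebra_simps)
qed

section \<open>Realisations as subspaces of the domain of the adjoint\<close>

definition graph_closed :: "'h set \<Rightarrow> bool" where
  "graph_closed X \<longleftrightarrow> (\<forall>f x y. (\<forall>n. f n \<in> X) \<longrightarrow> f \<longlonglongrightarrow> x \<longrightarrow> (\<lambda>n. As (f n)) \<longlonglongrightarrow> y \<longrightarrow> x \<in> X)"

lemma graph_closedD:
  "graph_closed X \<Longrightarrow> (\<And>n. f n \<in> X) \<Longrightarrow> f \<longlonglongrightarrow> x \<Longrightarrow> (\<lambda>n. As (f n)) \<longlonglongrightarrow> y \<Longrightarrow> x \<in> X"
  unfolding graph_closed_def by blast

lemma restrict_dom: "X \<subseteq> D \<Longrightarrow> dom (adjoint_op A |` X) = X"
  by auto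

lemma restrict_eq_iff:
  "X \<subseteq> D \<Longrightarrow> Y \<subseteq> D \<Longrightarrow> adjoint_op A |` X = adjoint_op A |` Y \<longleftrightarrow> X = Y"
  by (metis restrict_dom)

lemma linear_op_restrict:
  assumes "csubspace X" "X \<subseteq> D"
  shows "linear_op (adjoint_op A |` X)"
proof -
  have sub: "u + v \<in> X" "c *\<^sub>C u \<in> X" if "u \<in> X" "v \<in> X" for u v c
    using that assms(1) complex_vector.subspace_add complex_vector.subspace_scale by blast+
  have inD: "u \<in> D" if "u \<in> X" for u using that assms(2) by blast
  show ?thesis
    unfolding linear_op_def restrict_dom[OF assms(2)]
    using assms(1) sub inD by (simp add: adj_add adj_scale del: domIff)
qed

text \<open>A realisation is the restriction of the adjoint to its own domain, so its properties can
  be translated into properties of a subspace \<open>X\<close>.\<close>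

lemma realisation_iff:
  "realisation A B \<longleftrightarrow> (\<exists>X. B = adjoint_op A |` X \<and> csubspace X \<and> dom A \<subseteq> X \<and> X \<subseteq> D)"
proof
  assume B: "realisation A B"
  then have le: "A \<subseteq>\<^sub>m B" "B \<subseteq>\<^sub>m adjoint_op A" and "csubspace (dom B)"
    unfolding realisation_def linear_op_def by blast+
  moreover have "B = adjoint_op A |` dom B"
  proof
    fix x
    show "B x = (adjoint_op A |` dom B) x"
      using le(2) unfolding map_le_def restrict_map_def by (cases "x \<in> dom B") auto
  qed
  ultimately show "\<exists>X. B = adjoint_op A |` X \<and> csubspace X \<and> dom A \<subseteq> X \<and> X \<subseteq> D"
    using map_le_implies_dom_le by blast
next
  assume "\<exists>X. B = adjoint_op A |` X \<and> csubspace X \<and> dom A \<subseteq> X \<and> X \<subseteq> D"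
  then obtain X where X: "B = adjoint_op A |` X" "csubspace X" "dom A \<subseteq> X" "X \<subseteq> D" by blast
  have "A u = (adjoint_op A |` X) u" if "u \<in> dom A" for u
    using adj_extends[OF that] that X(3) by (auto simp: restrict_map_def subset_iff)
  then have "A \<subseteq>\<^sub>m B"
    unfolding X(1) map_le_def by blast
  moreover have "B \<subseteq>\<^sub>m adjoint_op A"
    unfolding X(1) by (simp add: map_le_def)
  ultimately show "realisation A B"
    unfolding realisation_def using linear_op_restrict[OF X(2,4)] X(1) by blast
qed

lemma symmetric_op_restrict_iff:
  assumes "X \<subseteq> D"
  shows "symmetric_op (adjoint_op A |` X) \<longleftrightarrow> (\<forall>u\<in>X. \<forall>v\<in>X. bf u v = 0)"
  unfolding symmetric_op_def restrict_dom[OF assms] bf_eq_0_iff by auto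

text \<open>\<open>graph_closed\<close> is sequential closedness in the graph norm of the adjoint.
  In the backward direction, closedness of the adjoint ensures that the limit of the values is the
  value at the limit.\<close>

lemma closed_op_restrict_iff:
  assumes "X \<subseteq> D"
  shows "closed_op (adjoint_op A |` X) \<longleftrightarrow> graph_closed X"
proof -
  have mem: "(u, w) \<in> Map.graph (adjoint_op A |` X) \<longleftrightarrow> u \<in> X \<and> w = As u" for u w
    using assms unfolding Map.graph_def restrict_map_def by auto
  show ?thesis
  proof
    assume *: "closed_op (adjoint_op A |` X)"
    show "graph_closed X"
      unfolding graph_closed_def
    proof (intro allI impI)
      fix f x y assume f: "\<forall>n. f n \<in> X" "f \<longlonglongrightarrow> x" "(\<lambda>n. As (f n)) \<longlonglongrightarrow> y"
      then have "\<And>n. (f n, As (f n)) \<in> Map.graph (adjoint_op A |` X)"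
        unfolding mem by blast
      then have "(x, y) \<in> Map.graph (adjoint_op A |` X)"
        using closed_sequentially[OF _ _ tendsto_Pair[OF f(2,3)]] * unfolding closed_op_def by blast
      then show "x \<in> X" unfolding mem by blast
    qed
  next
    assume *: "graph_closed X"
    show "closed_op (adjoint_op A |` X)"
      unfolding closed_op_def closed_sequential_limits
    proof (intro allI impI, elim conjE)
      fix g l assume g: "\<forall>n. g n \<in> Map.graph (adjoint_op A |` X)" "g \<longlonglongrightarrow> l"
      have fst: "fst (g n) \<in> X" "snd (g n) = As (fst (g n))" for n
        using g(1) mem[of "fst (g n)" "snd (g n)"] by simp_all
      have lim: "(\<lambda>n. fst (g n)) \<longlonglongrightarrow> fst l" "(\<lambda>n. As (fst (g n))) \<longlonglongrightarrow> snd l"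
        using tendsto_fst[OF g(2)] tendsto_snd[OF g(2)] unfolding fst(2) by simp_all
      have "fst l \<in> X"
        using graph_closedD[OF * fst(1) lim] .
      moreover have "As (fst l) = snd l"
        using adj_closed(2)[OF _ lim] fst(1) assms by blast
      ultimately show "l \<in> Map.graph (adjoint_op A |` X)"
        using mem[of "fst l" "snd l"] by simp
    qed
  qed
qed

text \<open>Because \<open>dom A \<subseteq> X\<close>, the adjoint of the restriction lies below
  \<open>adjoint_op A\<close>. It is therefore determined by its domain, the orthogonal complement
  of \<open>X\<close> for the boundary form.\<close>

lemma selfadjoint_op_restrict_iff:
  assumes "dom A \<subseteq> X" "X \<subseteq> D"
  shows "selfadjoint_op (adjoint_op A |` X) \<longleftrightarrow> X = {y \<in> D. \<forall>x\<in>X. bf x y = 0}"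
proof -
  let ?B = "adjoint_op A |` X" and ?Y = "{y \<in> D. \<forall>x\<in>X. bf x y = 0}"
  have "closure (dom ?B) = UNIV"
    unfolding restrict_dom[OF assms(2)]
    using dense closure_mono[OF assms(1)] unfolding densely_defined_def by blast
  then have dense_B: "densely_defined ?B" unfolding densely_defined_def .
  have adj_iff: "adjoint_op ?B v = Some w \<longleftrightarrow> (adjoint_op A |` ?Y) v = Some w" for v w
  proof -
    have "adjoint_op ?B v = Some w \<longleftrightarrow> (\<forall>x\<in>X. cinner (As x) v = cinner x w)"
      unfolding adjoint_op_eq_Some_iff[OF dense_B] restrict_dom[OF assms(2)] by simp
    also have "\<dots> \<longleftrightarrow> v \<in> ?Y \<and> As v = w"
    proof
      assume *: "\<forall>x\<in>X. cinner (As x) v = cinner x w"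
      then have "cinner (the (A x)) v = cinner x w" if "x \<in> dom A" for x
        unfolding adj_extends(2)[OF that, symmetric] using * assms(1) that by blast
      then have "v \<in> D" "As v = w" using adj_eqI by blast+
      then show "v \<in> ?Y \<and> As v = w"
        using * by (simp add: bf_eq_0_iff del: domIff)
    next
      assume "v \<in> ?Y \<and> As v = w"
      then show "\<forall>x\<in>X. cinner (As x) v = cinner x w"
        by (auto simp: bf_eq_0_iff)
    qed
    also have "\<dots> \<longleftrightarrow> (adjoint_op A |` ?Y) v = Some w"
      unfolding restrict_map_def by auto
    finally show ?thesis .
  qed
  have option_eqI: "a = b" if "\<And>w. a = Some w \<longleftrightarrow> b = Some w" for a b :: "'h option"
  proof (cases a)
    case None
    with that[of "the b"] show ?thesis by (cases b) simp_all
  next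
    case (Some x)
    with that[of x] show ?thesis by simp
  qed
  have "adjoint_op ?B = adjoint_op A |` ?Y"
    by (rule ext, rule option_eqI, rule adj_iff)
  moreover have "?Y \<subseteq> D" by (rule Collect_restrict)
  ultimately have "adjoint_op ?B = ?B \<longleftrightarrow> X = ?Y"
    using restrict_eq_iff[of ?Y X] assms(2) by (simp only: eq_commute[of ?Y])
  then show ?thesis
    unfolding selfadjoint_op_def using dense_B by (simp only: simp_thms)
qed

lemma graph_closed_D0:
  assumes "graph_closed X" "dom A \<subseteq> X"
  shows "D0 \<subseteq> X"
proof
  fix u assume "u \<in> D0"
  then obtain f where f: "\<And>n. f n \<in> dom A" "f \<longlonglongrightarrow> u" "(\<lambda>n. As (f n)) \<longlonglongrightarrow> As u"
    unfolding mem_D0_iff mem_closure_graph_iff by blast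
  have "f n \<in> X" for n using f(1) assms(2) by blast
  from graph_closedD[OF assms(1) this f(2,3)] show "u \<in> X" .
qed

text \<open>Orthogonality to a fixed \<open>z\<close> in the boundary form survives graph limits, so
  an orthogonal complement is closed in the graph norm.\<close>

lemma graph_closed_selfadjoint:
  assumes "X = {y \<in> D. \<forall>x\<in>X. bf x y = 0}"
  shows "graph_closed X"
  unfolding graph_closed_def
proof (intro allI impI)
  fix f x y assume f: "\<forall>n. f n \<in> X" "f \<longlonglongrightarrow> x" "(\<lambda>n. As (f n)) \<longlonglongrightarrow> y"
  have fD: "f n \<in> D" and f0: "z \<in> X \<Longrightarrow> bf z (f n) = 0" for n z
    using f(1) assms by blast+
  have x: "x \<in> D" "As x = y"
    using adj_closed[OF fD f(2,3)] by blast+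
  have "bf z x = 0" if "z \<in> X" for z
  proof -
    have "(\<lambda>n. cinner (As z) (f n)) \<longlonglongrightarrow> cinner (As z) x"
      by (intro cinner.tendsto tendsto_const f)
    moreover have "(\<lambda>n. cinner (As z) (f n)) \<longlonglongrightarrow> cinner z (As x)"
      unfolding f0[OF that, unfolded bf_eq_0_iff] x(2) by (intro cinner.tendsto tendsto_const f)
    ultimately show ?thesis
      unfolding bf_eq_0_iff by (rule LIMSEQ_unique)
  qed
  then show "x \<in> X" using assms x(1) by blast
qed

end

section \<open>The decomposition of the domain of the adjoint\<close>

text \<open>\<open>S1\<close> and \<open>S2\<close> enter through these consequences of their
  hypotheses, with the lower bound \<open>\<mu>\<close> as a parameter. A second instance, with
  \<open>S1 = 0\<close> and \<open>S2\<close> multiplication by \<open>\<beta>\<close>, describes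
  the deficiency spaces, so that the two pairs can be compared.\<close>

locale symmetric_perturbation = symmetric_operator A
  for A :: "'h::chilbert_space \<rightharpoonup> 'h" +
  fixes S1 S2 :: "'h \<Rightarrow> 'h" and \<mu> :: real
  assumes S1: "bounded_linear S1" "\<And>c u. S1 (c *\<^sub>C u) = c *\<^sub>C S1 u"
      "\<And>u v. cinner (S1 u) v = cinner u (S1 v)"
    and S2: "bounded_linear S2" "\<And>c u. S2 (c *\<^sub>C u) = c *\<^sub>C S2 u"
      "\<And>u v. cinner (S2 u) v = cinner u (S2 v)"
    and \<mu>_pos: "\<mu> > 0" and S2_ge: "\<And>u. Re (cinner (S2 u) u) \<ge> \<mu> * (norm u)\<^sup>2"
begin

sublocale S1: bounded_linear S1 by (rule S1)
sublocale S2: bounded_linear S2 by (rule S2)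

text \<open>\<open>K \<i>\<close> is \<open>ker_plus\<close> and \<open>K (- \<i>)\<close> is
  \<open>ker_minus\<close>; keeping \<open>c\<close> free lets one argument serve both
  signs.\<close>

definition K :: "complex \<Rightarrow> 'h set" where
  "K c = {u \<in> D. As u = S1 u + c *\<^sub>C S2 u}"

lemma K_D: "u \<in> K c \<Longrightarrow> u \<in> D"
  and K_As: "u \<in> K c \<Longrightarrow> As u = S1 u + c *\<^sub>C S2 u"
  unfolding K_def by auto

lemma K_I: "u \<in> D \<Longrightarrow> As u = S1 u + c *\<^sub>C S2 u \<Longrightarrow> u \<in> K c"
  unfolding K_def by auto

lemma op_ker_perturb_adjoint:
  assumes "\<And>u. T u = - (S1 u + c *\<^sub>C S2 u)"
  shows "op_ker (perturb (adjoint_op A) T) = K c"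
  unfolding op_ker_def perturb_def K_def assms by (auto simp: eq_neg_iff_add_eq_0 algebra_simps)

lemma ker_plus_eq: "ker_plus A S1 S2 = K \<i>"
  unfolding ker_plus_def by (rule op_ker_perturb_adjoint) simp

lemma ker_minus_eq: "ker_minus A S1 S2 = K (- \<i>)"
  unfolding ker_minus_def by (rule op_ker_perturb_adjoint) simp

lemma K_subspace: "csubspace (K c)"
proof (rule complex_vector.subspaceI)
  show "0 \<in> K c"
    by (rule K_I) (simp_all add: adj_zero S1.zero S2.zero del: domIff)
  show "x + y \<in> K c" if "x \<in> K c" "y \<in> K c" for x y
    using that K_D K_As by (intro K_I) (simp_all add: adj_add S1.add S2.add scaleC_add_right del: domIff)
  show "a *\<^sub>C x \<in> K c" if "x \<in> K c" for a x
    using that K_D K_As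
    by (intro K_I) (simp_all add: adj_scale S1(2) S2(2) scaleC_add_right scaleC_scaleC mult.commute del: domIff)
qed

text \<open>On \<open>K c\<close> the adjoint agrees with a bounded operator, so norm convergence
  there is already graph convergence.\<close>

lemma K_closed: "closed (K c)"
  unfolding closed_sequential_limits
proof (intro allI impI, elim conjE)
  fix f x assume f: "\<forall>n. f n \<in> K c" "f \<longlonglongrightarrow> x"
  have "(\<lambda>n. S1 (f n) + c *\<^sub>C S2 (f n)) \<longlonglongrightarrow> S1 x + c *\<^sub>C S2 x"
    by (intro tendsto_add scaleC.tendsto tendsto_const S1.tendsto S2.tendsto f)
  moreover have "As (f n) = S1 (f n) + c *\<^sub>C S2 (f n)" for n
    using f(1) K_As by blast
  ultimately have "(\<lambda>n. As (f n)) \<longlonglongrightarrow> S1 x + c *\<^sub>C S2 x"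
    by simp
  then show "x \<in> K c"
    using adj_closed[of f x] f K_D K_I by blast
qed

lemma S1_Im: "Im (cinner (S1 u) u) = 0"
proof -
  have "cinner (S1 u) u = cnj (cinner (S1 u) u)"
    using S1(3)[of u u] cinner_commute by metis
  then show ?thesis
    by (simp add: complex_eq_iff)
qed

lemma S2_Re_pos: "u \<noteq> 0 \<Longrightarrow> Re (cinner (S2 u) u) > 0"
  using S2_ge[of u] \<mu>_pos by (smt (verit) mult_pos_pos norm_eq_zero zero_less_power2)

lemma S2_eq_0_iff: "cinner (S2 u) u = 0 \<longleftrightarrow> u = 0"
  using S2_Re_pos[of u] by (cases "u = 0") auto

text \<open>\<open>S1\<close> cancels by symmetry, and for purely imaginary \<open>c\<close> the two
  \<open>S2\<close> terms add up. With \<open>v\<close> in \<open>K (- c)\<close> instead, they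
  cancel.\<close>

lemma bf_K: "u \<in> K c \<Longrightarrow> v \<in> K c \<Longrightarrow> cnj c = - c \<Longrightarrow> bf u v = 2 * \<i> * c * cinner (S2 u) v"
  unfolding boundary_form_def
  by (simp add: K_As cinner_simps S1(3) S2(3) algebra_simps)

lemma bf_K_orthogonal: "u \<in> K c \<Longrightarrow> v \<in> K (- c) \<Longrightarrow> cnj c = - c \<Longrightarrow> bf u v = 0"
  unfolding boundary_form_def
  by (simp add: K_As cinner_simps S1(3) S2(3) algebra_simps)

text \<open>The quadratic forms of the closure and of \<open>S1\<close> are real, so the imaginary
  part of the shifted form is that of \<open>S2\<close> up to sign, and coercivity of
  \<open>S2\<close> applies.\<close>

lemma closure_shift_bounded_below:
  assumes "u \<in> D0" "c \<in> {\<i>, - \<i>}"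
  shows "\<mu> * norm u \<le> norm (As u - S1 u + c *\<^sub>C S2 u)"
proof (cases "u = 0")
  case False
  have "cinner (As u) u = cnj (cinner (As u) u)"
    using closure_op_cinner[OF assms(1) closure_op_adj(1)[OF assms(1)]] cinner_commute by metis
  then have "Im (cinner (As u) u) = 0" by (simp add: complex_eq_iff)
  then have "\<bar>Im (cinner (As u - S1 u + c *\<^sub>C S2 u) u)\<bar> = \<bar>Re (cinner (S2 u) u)\<bar>"
    using assms(2) S1_Im[of u] by (auto simp: cinner_simps)
  also have "\<dots> \<ge> \<mu> * (norm u)\<^sup>2"
    using S2_ge[of u] by linarith
  finally have "\<mu> * (norm u)\<^sup>2 \<le> cmod (cinner (As u - S1 u + c *\<^sub>C S2 u) u)"
    using abs_Im_le_cmod order_trans by blast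
  also have "\<dots> \<le> norm (As u - S1 u + c *\<^sub>C S2 u) * norm u"
    by (rule cinner_cauchy_schwarz)
  finally show ?thesis
    using False by (simp add: power2_eq_square)
qed (simp add: S1.zero S2.zero adj_zero)

text \<open>The lower bound makes the preimages of a convergent sequence Cauchy; closedness of the
  closure of \<open>A\<close> then places their limit in \<open>D0\<close>.\<close>

lemma closure_shift_range_closed:
  assumes c: "c \<in> {\<i>, - \<i>}"
  shows "closed ((\<lambda>u. As u - S1 u + c *\<^sub>C S2 u) ` D0)" (is "closed (?T ` D0)")
  unfolding closed_sequential_limits
proof (intro allI impI, elim conjE)
  fix f y assume "\<forall>n. f n \<in> ?T ` D0" and lim: "f \<longlonglongrightarrow> y"
  then have "\<forall>n. \<exists>u. u \<in> D0 \<and> f n = ?T u" by blast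
  then obtain g where g: "\<And>n. g n \<in> D0" "\<And>n. f n = ?T (g n)" by metis
  have diff: "f m - f n = ?T (g m - g n)" for m n
    using g closure_op_adj(1)[OF g(1)]
    by (simp add: adj_diff S1.diff S2.diff scaleC.diff_right del: domIff)
  have bound: "\<mu> * norm (g m - g n) \<le> norm (f m - f n)" for m n
    unfolding diff
    by (rule closure_shift_bounded_below[OF complex_vector.subspace_diff[OF D0_subspace g(1) g(1)] c])
  have "Cauchy g"
  proof (rule metric_CauchyI)
    fix e :: real assume "e > 0"
    then have "\<mu> * e > 0" using \<mu>_pos by simp
    then obtain N where N: "\<forall>m\<ge>N. \<forall>n\<ge>N. dist (f m) (f n) < \<mu> * e"
      using LIMSEQ_imp_Cauchy[OF lim] metric_CauchyD by blast
    have "dist (g m) (g n) < e" if "m \<ge> N" "n \<ge> N" for m n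
    proof -
      have "\<mu> * norm (g m - g n) < \<mu> * e"
        using bound[of m n] N that by (metis dist_norm order_le_less_trans)
      then show ?thesis using \<mu>_pos by (simp add: dist_norm)
    qed
    then show "\<exists>M. \<forall>m\<ge>M. \<forall>n\<ge>M. dist (g m) (g n) < e" by blast
  qed
  then obtain x where x: "g \<longlonglongrightarrow> x"
    using Cauchy_convergent convergent_def by blast
  have "(\<lambda>n. f n + S1 (g n) - c *\<^sub>C S2 (g n)) \<longlonglongrightarrow> y + S1 x - c *\<^sub>C S2 x"
    by (intro tendsto_add tendsto_diff scaleC.tendsto tendsto_const S1.tendsto S2.tendsto x lim)
  then have "(\<lambda>n. As (g n)) \<longlonglongrightarrow> y + S1 x - c *\<^sub>C S2 x"
    using g(2) by simp
  from D0_closed[OF g(1) x this] show "y \<in> ?T ` D0"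
    by (intro image_eqI[of _ _ x]) auto
qed

text \<open>The orthogonal complement of the closed range lies in \<open>K c\<close>, since
  conjugation reverses the sign of \<open>c\<close> in the adjoint of the shifted operator. So
  \<open>y\<close> minus its projection \<open>r\<close> to the range is in \<open>K c\<close> and
  orthogonal to both \<open>y\<close> and \<open>r\<close>, hence zero.\<close>

lemma orthogonal_K_in_range:
  assumes c: "c \<in> {\<i>, - \<i>}" and y: "\<And>m. m \<in> K c \<Longrightarrow> cinner y m = 0"
  shows "\<exists>u\<in>D0. y = As u - S1 u + c *\<^sub>C S2 u"
proof -
  let ?T = "\<lambda>u. As u - S1 u + c *\<^sub>C S2 u"
  have "csubspace (?T ` D0)"
  proof (rule complex_vector.subspaceI)
    show "0 \<in> ?T ` D0"
      using complex_vector.subspace_0[OF D0_subspace]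
      by (intro image_eqI[of _ _ 0]) (simp_all add: adj_zero S1.zero S2.zero)
    show "x + x' \<in> ?T ` D0" if xs: "x \<in> ?T ` D0" "x' \<in> ?T ` D0" for x x'
    proof -
      obtain u v where "u \<in> D0" "v \<in> D0" "x = ?T u" "x' = ?T v"
        using xs by blast
      then show ?thesis
        using closure_op_adj(1)[of u] closure_op_adj(1)[of v]
        by (intro image_eqI[of _ _ "u + v"] D0_add)
          (simp_all add: adj_add S1.add S2.add scaleC_add_right del: domIff)
    qed
    show "a *\<^sub>C x \<in> ?T ` D0" if xs: "x \<in> ?T ` D0" for a x
    proof -
      obtain u where "u \<in> D0" "x = ?T u"
        using xs by blast
      then show ?thesis
        using closure_op_adj(1)[of u]
        by (intro image_eqI[of _ _ "a *\<^sub>C u"] D0_scale)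
          (simp_all add: adj_scale S1(2) S2(2) scaleC_add_right scaleC.diff_right scaleC_scaleC
            mult.commute del: domIff)
    qed
  qed
  then obtain r where r: "r \<in> ?T ` D0" "\<And>m. m \<in> ?T ` D0 \<Longrightarrow> cinner (y - r) m = 0"
    using orthogonal_decomposition[OF _ closure_shift_range_closed[OF c]] by blast
  have cc: "cnj c = - c" using c by auto
  define s where "s = y - r"
  have "s \<in> K c"
  proof -
    have "cinner (the (A u)) s = cinner u (S1 s + c *\<^sub>C S2 s)" if "u \<in> dom A" for u
    proof -
      have "cinner s (?T u) = 0"
        unfolding s_def using r(2) dom_subset_D0[OF that] by blast
      then have "cinner (?T u) s = 0"
        by (metis cinner_commute complex_cnj_zero)
      then show ?thesis
        using cc adj_extends(2)[OF that] by (simp add: cinner_simps S1(3) S2(3) algebra_simps)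
    qed
    then show ?thesis
      using adj_eqI by (intro K_I) blast+
  qed
  have "cinner s s = cinner y s - cinner r s"
    by (simp add: s_def cinner_simps)
  also have "cinner r s = cnj (cinner s r)"
    by (rule cinner_commute)
  also have "cinner s r = 0"
    unfolding s_def using r by blast
  finally have "cinner s s = 0"
    using y[OF \<open>s \<in> K c\<close>] by simp
  then have "y = r"
    unfolding s_def by (simp add: cinner_eq_zero_iff)
  then show ?thesis using r(1) by blast
qed

lemma decomposition_exists:
  assumes c: "c \<in> {\<i>, - \<i>}" and "u \<in> D"
  obtains u0 p m where "u0 \<in> D0" "p \<in> K c" "m \<in> K (- c)" "u = u0 + p + m"
proof -
  \<comment> \<open>The shifted operator annihilates \<open>K (- c)\<close> and acts as
    \<open>2 * c\<close> times \<open>S2\<close> on \<open>K c\<close>. Hence \<open>p\<close> has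
    to make \<open>h - (2 * c) *\<^sub>C S2 p\<close> an element of the range over
    \<open>D0\<close>, for which orthogonality to \<open>K c\<close> suffices.\<close>
  define h where "h = As u - S1 u + c *\<^sub>C S2 u"
  \<comment> \<open>\<open>- c / 2\<close> is the inverse of \<open>2 * c\<close>, because
    \<open>c * c = - 1\<close>.\<close>
  obtain p where p: "p \<in> K c" "\<And>m. m \<in> K c \<Longrightarrow> cinner (S2 p) m = cinner ((- c / 2) *\<^sub>C h) m"
    using coercive_representation[OF K_subspace K_closed S2 \<mu>_pos S2_ge] by blast
  have c2: "c * (c * x) = - x" for x using c by auto
  have "cinner (h - (2 * c) *\<^sub>C S2 p) m = 0" if "m \<in> K c" for m
    using p(2)[OF that] c2 by (simp add: cinner_simps)
  then obtain u0 where u0: "u0 \<in> D0" "h - (2 * c) *\<^sub>C S2 p = As u0 - S1 u0 + c *\<^sub>C S2 u0"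
    using orthogonal_K_in_range[OF c] by blast
  note D = \<open>u \<in> D\<close> closure_op_adj(1)[OF u0(1)] K_D[OF p(1)]
  have "(2 * c) *\<^sub>C S2 p = c *\<^sub>C S2 p + c *\<^sub>C S2 p"
    by (metis mult_2 scaleC_add_left)
  then have "As u - As u0 - As p = S1 (u - u0 - p) + (- c) *\<^sub>C S2 (u - u0 - p)"
    using u0(2) K_As[OF p(1)] unfolding h_def S1.diff S2.diff scaleC.diff_right scaleC.minus_left
    by (simp add: algebra_simps)
  then have "u - u0 - p \<in> K (- c)"
    using D by (intro K_I) (simp_all add: adj_diff del: domIff)
  then show thesis
    using that[OF u0(1) p(1), of "u - u0 - p"] by simp
qed

lemma bf_decomposition:
  assumes c: "c \<in> {\<i>, - \<i>}"
    and "u0 \<in> D0" "p \<in> K c" "m \<in> K (- c)" "v0 \<in> D0" "q \<in> K c" "n \<in> K (- c)"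
  shows "bf (u0 + p + m) (v0 + q + n) = bf p q + bf m n"
proof -
  have cc: "cnj c = - c" using c by auto
  have "bf p n = 0" using bf_K_orthogonal assms cc by blast
  moreover have "bf m q = 0" using bf_K_orthogonal[of m "-c" q] assms cc by simp
  moreover note D = K_D[OF assms(3)] K_D[OF assms(4)] K_D[OF assms(6)] K_D[OF assms(7)]
    closure_op_adj(1)[OF assms(2)] closure_op_adj(1)[OF assms(5)]
  ultimately show ?thesis
    using assms(2,5) by (simp add: bf_add_left bf_add_right adj_add bf_D0_left bf_D0_right del: domIff)
qed

text \<open>Pairing the vanishing sum with \<open>p\<close> and with \<open>m\<close> isolates
  \<open>bf p p\<close> and \<open>bf m m\<close>, and the form is definite on each kernel.\<close>

lemma decomposition_zero:
  assumes c: "c \<in> {\<i>, - \<i>}"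
    and "u0 \<in> D0" "p \<in> K c" "m \<in> K (- c)" "u0 + p + m = 0"
  shows "u0 = 0" "p = 0" "m = 0"
proof -
  have z: "0 \<in> D0" "0 \<in> K c" "0 \<in> K (- c)"
    using K_subspace D0_subspace complex_vector.subspace_0 by blast+
  have cc: "cnj c = - c" "c \<noteq> 0" using c by auto
  have bf0: "bf 0 v = 0" for v
    using bf_scale_left[OF adj_zero(1), of 0 v] by simp
  have "bf p p = 0"
    using bf_decomposition[OF c assms(2,3,4) z(1) assms(3) z(3)] assms(5) bf0 bf_commute[of m 0]
    by simp
  then show "p = 0"
    using bf_K[OF assms(3,3) cc(1)] cc(2) S2_eq_0_iff by simp
  have "bf m m = 0"
    using bf_decomposition[OF c assms(2,3,4) z(1,2) assms(4)] assms(5) bf0 bf_commute[of p 0]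
    by simp
  then show "m = 0"
    using bf_K[OF assms(4,4)] cc S2_eq_0_iff by simp
  then show "u0 = 0" using \<open>p = 0\<close> assms(5) by simp
qed

lemma decomposition_unique:
  assumes c: "c \<in> {\<i>, - \<i>}"
    and u: "u0 \<in> D0" "p \<in> K c" "m \<in> K (- c)" and v: "v0 \<in> D0" "q \<in> K c" "n \<in> K (- c)"
    and "u0 + p + m = v0 + q + n"
  shows "u0 = v0 \<and> p = q \<and> m = n"
proof -
  have "(u0 - v0) + (p - q) + (m - n) = 0"
    using assms(8) by (simp add: algebra_simps)
  moreover have "u0 - v0 \<in> D0" "p - q \<in> K c" "m - n \<in> K (- c)"
    using u v D0_subspace K_subspace complex_vector.subspace_diff by blast+
  ultimately show ?thesis
    using decomposition_zero[OF c] by (metis eq_iff_diff_eq_0)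
qed

lemma K_norm_bound: "u \<in> K c \<Longrightarrow> c \<in> {\<i>, - \<i>} \<Longrightarrow> 2 * \<mu> * (norm u)\<^sup>2 \<le> cmod (bf u u)"
proof -
  assume u: "u \<in> K c" and c: "c \<in> {\<i>, - \<i>}"
  have "cnj c = - c" "cmod c = 1" using c by auto
  then have "cmod (bf u u) = 2 * cmod (cinner (S2 u) u)"
    using bf_K[OF u u] by (simp add: norm_mult)
  moreover have "Re (cinner (S2 u) u) \<le> cmod (cinner (S2 u) u)"
    by (rule complex_Re_le_cmod)
  ultimately show ?thesis
    using S2_ge[of u] by linarith
qed

end

text \<open>A vector of \<open>S.K c\<close> is related to its \<open>T.K c\<close> component in the
  decomposition for the second pair. The signs of the form bound the vector by this component, so
  the comparison of orthonormal bases applies.\<close>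

lemma hilbert_dim_K_le:
  fixes A :: "'h::chilbert_space \<rightharpoonup> 'h"
  assumes "symmetric_perturbation A S1 S2 \<mu>" "symmetric_perturbation A T1 T2 \<nu>"
    and c: "c \<in> {\<i>, - \<i>}"
  shows "hilbert_dim (symmetric_perturbation.K A S1 S2 c)
    \<le>o hilbert_dim (symmetric_perturbation.K A T1 T2 c)"
proof -
  interpret S: symmetric_perturbation A S1 S2 \<mu> by fact
  interpret T: symmetric_perturbation A T1 T2 \<nu> by fact
  obtain B where B: "orthonormal_basis (S.K c) B" "hilbert_dim (S.K c) = |B|"
    using hilbert_dim_basis[OF S.K_subspace S.K_closed] .
  obtain B' where B': "orthonormal_basis (T.K c) B'" "hilbert_dim (T.K c) = |B'|"
    using hilbert_dim_basis[OF T.K_subspace T.K_closed] .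
  have cc: "cnj c = - c" and "cmod c = 1" using c by auto
  obtain C where C: "\<And>u. norm (T2 u) \<le> norm u * C" "C > 0"
    using T.S2.pos_bounded by blast
  \<comment> \<open>The summands other than \<open>p\<close> are existentially quantified, so
    linearity of the relation follows by combining witnesses.\<close>
  define R where "R u p \<longleftrightarrow> (\<exists>u0\<in>S.D0. \<exists>m\<in>T.K (- c). u = u0 + p + m)" for u p
  have "|B| \<le>o |B'|"
  proof (rule orthonormal_basis_card_le[OF B(1) B'(1), of R "sqrt (C / \<mu>)"])
    show "\<exists>p\<in>T.K c. R u p" if "u \<in> S.K c" for u
      using T.decomposition_exists[OF c S.K_D[OF that]] unfolding R_def by metis
    show "R 0 0"
      unfolding R_def using complex_vector.subspace_0[OF S.D0_subspace] complex_vector.subspace_0[OF T.K_subspace]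
      by (intro bexI[of _ 0]) auto
    show "R (u + v) (p + q)" if R: "R u p" "R v q" for u p v q
    proof -
      obtain u0 m v0 n where "u0 \<in> S.D0" "m \<in> T.K (- c)" "u = u0 + p + m"
        "v0 \<in> S.D0" "n \<in> T.K (- c)" "v = v0 + q + n"
        using R unfolding R_def by blast
      then show ?thesis
        unfolding R_def using S.D0_add complex_vector.subspace_add[OF T.K_subspace]
        by (intro bexI[of _ "u0 + v0"] bexI[of _ "m + n"]) (simp_all add: algebra_simps del: domIff)
    qed
    show "R (a *\<^sub>C u) (a *\<^sub>C p)" if R: "R u p" for a u p
    proof -
      obtain u0 m where "u0 \<in> S.D0" "m \<in> T.K (- c)" "u = u0 + p + m"
        using R unfolding R_def by blast
      then show ?thesis
        unfolding R_def using S.D0_scale complex_vector.subspace_scale[OF T.K_subspace]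
        by (intro bexI[of _ "a *\<^sub>C u0"] bexI[of _ "a *\<^sub>C m"]) (simp_all add: scaleC_add_right del: domIff)
    qed
    show "norm u \<le> sqrt (C / \<mu>) * norm p" if R: "R u p" and u: "u \<in> S.K c" and p: "p \<in> T.K c" for u p
    proof -
      obtain u0 m where um: "u0 \<in> S.D0" "m \<in> T.K (- c)" "u = u0 + p + m"
        using R unfolding R_def by blast
      have "S.bf u u = S.bf p p + S.bf m m"
        unfolding um(3) using T.bf_decomposition[OF c um(1) p um(2) um(1) p um(2)] .
      then have "2 * \<i> * c * cinner (S2 u) u = 2 * \<i> * c * (cinner (T2 p) p - cinner (T2 m) m)"
        using S.bf_K[OF u u cc] T.bf_K[OF p p cc] T.bf_K[OF um(2) um(2)] cc
        by (simp add: algebra_simps)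
      then have "cinner (S2 u) u = cinner (T2 p) p - cinner (T2 m) m"
        using c by auto
      moreover have "Re (cinner (T2 m) m) \<ge> 0"
        using T.S2_Re_pos[of m] by (cases "m = 0") auto
      ultimately have "Re (cinner (S2 u) u) \<le> Re (cinner (T2 p) p)" by simp
      also have "\<dots> \<le> cmod (cinner (T2 p) p)"
        by (rule complex_Re_le_cmod)
      also have "\<dots> \<le> norm (T2 p) * norm p"
        by (rule cinner_cauchy_schwarz)
      also have "\<dots> \<le> (norm p * C) * norm p"
        by (intro mult_right_mono C) simp
      finally have "\<mu> * (norm u)\<^sup>2 \<le> C * (norm p)\<^sup>2"
        using S.S2_ge[of u] by (simp add: power2_eq_square algebra_simps)
      then have "(norm u)\<^sup>2 \<le> (sqrt (C / \<mu>) * norm p)\<^sup>2"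
        using C(2) S.\<mu>_pos by (simp add: power_mult_distrib field_simps)
      moreover have "0 \<le> sqrt (C / \<mu>) * norm p"
        using C(2) S.\<mu>_pos by simp
      ultimately show ?thesis
        by (rule power2_le_imp_le)
    qed
  qed
  then show ?thesis
    using B(2) B'(2) by simp
qed

section \<open>Extensions\<close>

context symmetric_perturbation
begin

section \<open>Norm estimates for the components\<close>

lemma K_As_bound:
  obtains k where "k > 0" "\<And>c u. c \<in> {\<i>, - \<i>} \<Longrightarrow> u \<in> K c \<Longrightarrow> norm (As u) \<le> k * norm u"
proof -
  obtain k1 k2 where k: "k1 > 0" "\<And>u. norm (S1 u) \<le> norm u * k1" "k2 > 0" "\<And>u. norm (S2 u) \<le> norm u * k2"
    using S1.pos_bounded S2.pos_bounded by blast
  have "norm (As u) \<le> (k1 + k2) * norm u" if c: "c \<in> {\<i>, - \<i>}" and u: "u \<in> K c" for c u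
  proof -
    have "cmod c = 1" using c by auto
    then have "norm (As u) \<le> norm (S1 u) + norm (S2 u)"
      using norm_triangle_ineq[of "S1 u" "c *\<^sub>C S2 u"] by (simp add: K_As[OF u] norm_scaleC)
    then show ?thesis using k(2)[of u] k(4)[of u] by (simp add: algebra_simps)
  qed
  then show thesis using that[of "k1 + k2"] k(1,3) by simp
qed

text \<open>Pairing \<open>v0 + q + n\<close> with \<open>n\<close> leaves \<open>bf n n\<close>,
  which dominates \<open>2 * \<mu> * (norm n)\<^sup>2\<close>, while the pairing is bounded by the
  graph norm times \<open>norm n\<close>. So the projections to the kernels are continuous in the
  graph norm.\<close>

lemma component_bound:
  obtains k where "\<And>c v0 q n. c \<in> {\<i>, - \<i>} \<Longrightarrow> v0 \<in> D0 \<Longrightarrow> q \<in> K c \<Longrightarrow> n \<in> K (- c) \<Longrightarrow>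
    norm n \<le> (norm (As (v0 + q + n)) + k * norm (v0 + q + n)) / (2 * \<mu>)"
proof -
  obtain k where k: "k > 0" "\<And>c u. c \<in> {\<i>, - \<i>} \<Longrightarrow> u \<in> K c \<Longrightarrow> norm (As u) \<le> k * norm u"
    using K_As_bound by blast
  have "norm n \<le> (norm (As (v0 + q + n)) + k * norm (v0 + q + n)) / (2 * \<mu>)"
    if c: "c \<in> {\<i>, - \<i>}" and v: "v0 \<in> D0" "q \<in> K c" "n \<in> K (- c)" for c v0 q n
  proof (cases "n = 0")
    case False
    let ?v = "v0 + q + n"
    have c': "- c \<in> {\<i>, - \<i>}" using c by auto
    have z: "0 \<in> D0" "0 \<in> K c"
      using complex_vector.subspace_0 D0_subspace K_subspace by blast+
    have "bf ?v (0 + 0 + n) = bf q 0 + bf n n"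
      using bf_decomposition[OF c v z v(3)] .
    moreover have "bf q 0 = 0"
      using bf_D0_right[OF z(1) K_D[OF v(2)]] .
    ultimately have "cmod (bf n n) \<le> norm (As ?v) * norm n + norm ?v * norm (As n)"
      using bf_bound[of ?v n] by simp
    also have "\<dots> \<le> norm (As ?v) * norm n + norm ?v * (k * norm n)"
      using k(2)[OF c' v(3)] by (intro add_left_mono mult_left_mono) simp_all
    finally have "2 * \<mu> * (norm n)\<^sup>2 \<le> norm (As ?v) * norm n + norm ?v * (k * norm n)"
      using K_norm_bound[OF v(3) c'] by linarith
    then have "(2 * \<mu> * norm n) * norm n \<le> (norm (As ?v) + k * norm ?v) * norm n"
      by (simp add: power2_eq_square algebra_simps)
    then have "2 * \<mu> * norm n \<le> norm (As ?v) + k * norm ?v"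
      using False by simp
    then show ?thesis
      using \<mu>_pos by (simp add: field_simps)
  qed (use \<mu>_pos k(1) in simp)
  then show thesis using that by blast
qed

lemma component_tendsto:
  assumes c: "c \<in> {\<i>, - \<i>}"
    and f: "\<And>n. u n \<in> D0" "\<And>n. p n \<in> K c" "\<And>n. m n \<in> K (- c)"
    and x: "x0 \<in> D0" "q \<in> K c" "r \<in> K (- c)"
    and lim: "(\<lambda>n. u n + p n + m n) \<longlonglongrightarrow> x0 + q + r"
      "(\<lambda>n. As (u n + p n + m n)) \<longlonglongrightarrow> As (x0 + q + r)"
  shows "m \<longlonglongrightarrow> r"
proof -
  obtain k where k: "\<And>c v0 q n. c \<in> {\<i>, - \<i>} \<Longrightarrow> v0 \<in> D0 \<Longrightarrow> q \<in> K c \<Longrightarrow> n \<in> K (- c) \<Longrightarrow>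
    norm n \<le> (norm (As (v0 + q + n)) + k * norm (v0 + q + n)) / (2 * \<mu>)"
    using component_bound by blast
  let ?f = "\<lambda>n. u n + p n + m n" and ?x = "x0 + q + r"
  have "norm (m n - r) \<le> (norm (As (?f n) - As ?x) + k * norm (?f n - ?x)) / (2 * \<mu>)" for n
  proof -
    have D: "?f n \<in> D" "?x \<in> D"
      using closure_op_adj(1)[OF f(1)[of n]] K_D[OF f(2)[of n]] K_D[OF f(3)[of n]]
        closure_op_adj(1)[OF x(1)] K_D[OF x(2)] K_D[OF x(3)] by (simp_all add: adj_add del: domIff)
    have eq: "(u n - x0) + (p n - q) + (m n - r) = ?f n - ?x"
      by (simp add: algebra_simps)
    have "u n - x0 \<in> D0" "p n - q \<in> K c" "m n - r \<in> K (- c)"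
      using f x D0_subspace K_subspace complex_vector.subspace_diff by blast+
    from k[OF c this] show ?thesis
      unfolding eq adj_diff(2)[OF D] .
  qed
  moreover have "(\<lambda>n. (norm (As (?f n) - As ?x) + k * norm (?f n - ?x)) / (2 * \<mu>)) \<longlonglongrightarrow>
      (norm (As ?x - As ?x) + k * norm (?x - ?x)) / (2 * \<mu>)"
    using \<mu>_pos by (intro tendsto_intros lim) simp
  then have "(\<lambda>n. (norm (As (?f n) - As ?x) + k * norm (?f n - ?x)) / (2 * \<mu>)) \<longlonglongrightarrow> 0"
    by simp
  ultimately have "(\<lambda>n. m n - r) \<longlonglongrightarrow> 0"
    by (rule Lim_null_comparison[OF always_eventually[OF allI]])
  then show ?thesis by (simp add: LIM_zero_iff)
qed

text \<open>On each kernel the absolute value of the form on the diagonal is comparable to the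
  squared Hilbert norm. Maps isometric for the forms are therefore bounded, with a constant
  independent of the map.\<close>

lemma isometry_bound:
  obtains k where "k > 0" "\<And>c p m. c \<in> {\<i>, - \<i>} \<Longrightarrow> p \<in> K c \<Longrightarrow> m \<in> K (- c) \<Longrightarrow>
    bf p p + bf m m = 0 \<Longrightarrow> norm p \<le> k * norm m"
proof -
  obtain k where k: "k > 0" "\<And>c u. c \<in> {\<i>, - \<i>} \<Longrightarrow> u \<in> K c \<Longrightarrow> norm (As u) \<le> k * norm u"
    using K_As_bound by blast
  have "norm p \<le> sqrt (k / \<mu>) * norm m"
    if c: "c \<in> {\<i>, - \<i>}" and pm: "p \<in> K c" "m \<in> K (- c)" "bf p p + bf m m = 0" for c p m
  proof -
    have c': "- c \<in> {\<i>, - \<i>}" using c by auto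
    have "bf p p = - bf m m" using pm(3) by (simp add: add_eq_0_iff2)
    then have "2 * \<mu> * (norm p)\<^sup>2 \<le> cmod (bf m m)"
      using K_norm_bound[OF pm(1) c] by simp
    also have "\<dots> \<le> norm (As m) * norm m + norm m * norm (As m)"
      by (rule bf_bound)
    also have "\<dots> \<le> (k * norm m) * norm m + norm m * (k * norm m)"
      using k(2)[OF c' pm(2)] by (intro add_mono mult_left_mono mult_right_mono) simp_all
    finally have "\<mu> * (norm p)\<^sup>2 \<le> k * (norm m)\<^sup>2"
      by (simp add: power2_eq_square)
    then have "(norm p)\<^sup>2 \<le> (sqrt (k / \<mu>) * norm m)\<^sup>2"
      using k(1) \<mu>_pos by (simp add: power_mult_distrib field_simps)
    moreover have "0 \<le> sqrt (k / \<mu>) * norm m"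
      using k(1) \<mu>_pos by simp
    ultimately show ?thesis by (rule power2_le_imp_le)
  qed
  then show thesis
    using that[of "sqrt (k / \<mu>)"] k(1) \<mu>_pos by simp
qed

text \<open>
  If \<open>X\<close> lies between \<open>dom (closure_op A)\<close> and \<open>dom (adjoint_op A)\<close>, this is the projection
  of \<open>X\<close> to \<open>K (- c)\<close> along the decomposition of \<open>dom (adjoint_op A)\<close>.
\<close>

definition component :: "complex \<Rightarrow> 'h set \<Rightarrow> 'h set" where
  "component c X = {m \<in> K (- c). \<exists>p\<in>K c. p + m \<in> X}"

lemma component_subspace:
  assumes "csubspace X"
  shows "csubspace (component c X)"
proof (rule complex_vector.subspaceI)
  have "0 \<in> K c" "0 \<in> K (- c)" "0 + 0 \<in> X"
    using complex_vector.subspace_0[OF K_subspace] complex_vector.subspace_0[OF assms] by simp_all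
  then show "0 \<in> component c X"
    unfolding component_def by blast
next
  fix m m' assume "m \<in> component c X" "m' \<in> component c X"
  then obtain p p' where "m \<in> K (- c)" "m' \<in> K (- c)" "p \<in> K c" "p' \<in> K c" "p + m \<in> X" "p' + m' \<in> X"
    unfolding component_def by blast
  then have "m + m' \<in> K (- c)" "p + p' \<in> K c" "(p + m) + (p' + m') \<in> X"
    using K_subspace assms complex_vector.subspace_add by blast+
  then show "m + m' \<in> component c X"
    unfolding component_def by (auto simp: algebra_simps intro!: bexI[of _ "p + p'"])
next
  fix a m assume "m \<in> component c X"
  then obtain p where "m \<in> K (- c)" "p \<in> K c" "p + m \<in> X"
    unfolding component_def by blast
  then have "a *\<^sub>C m \<in> K (- c)" "a *\<^sub>C p \<in> K c" "a *\<^sub>C (p + m) \<in> X"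
    using K_subspace assms complex_vector.subspace_scale by blast+
  then show "a *\<^sub>C m \<in> component c X"
    unfolding component_def by (auto simp: scaleC_add_right intro!: bexI[of _ "a *\<^sub>C p"])
qed

lemma bf_K_sum:
  assumes "c \<in> {\<i>, - \<i>}" "p \<in> K c" "m \<in> K (- c)" "q \<in> K c" "n \<in> K (- c)"
  shows "bf (p + m) (q + n) = bf p q + bf m n"
  using bf_decomposition[OF assms(1) _ assms(2,3) _ assms(4,5), of 0 0]
    complex_vector.subspace_0[OF D0_subspace] by simp

text \<open>When the form vanishes on \<open>X\<close>, the \<open>K c\<close> parts are controlled
  by the \<open>K (- c)\<close> parts and converge along with them. Graph convergence of the sums
  follows, and \<open>X\<close> contains the limit.\<close>

lemma component_closed:
  assumes c: "c \<in> {\<i>, - \<i>}" and X: "csubspace X" "graph_closed X"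
    and null: "\<And>x y. x \<in> X \<Longrightarrow> y \<in> X \<Longrightarrow> bf x y = 0"
  shows "closed (component c X)"
  unfolding closed_sequential_limits
proof (intro allI impI, elim conjE)
  fix f m assume "\<forall>n. f n \<in> component c X" and lim: "f \<longlonglongrightarrow> m"
  then have f: "f n \<in> K (- c)" "\<exists>p. p \<in> K c \<and> p + f n \<in> X" for n
    unfolding component_def by blast+
  from f(2) obtain p where p: "\<And>n. p n \<in> K c" "\<And>n. p n + f n \<in> X" by metis
  obtain k where k: "k > 0" "\<And>c p m. c \<in> {\<i>, - \<i>} \<Longrightarrow> p \<in> K c \<Longrightarrow> m \<in> K (- c) \<Longrightarrow>
    bf p p + bf m m = 0 \<Longrightarrow> norm p \<le> k * norm m"
    using isometry_bound by blast
  have bound: "norm (p i - p j) \<le> k * norm (f i - f j)" for i j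
  proof -
    have mem: "p i - p j \<in> K c" "f i - f j \<in> K (- c)" "(p i + f i) - (p j + f j) \<in> X"
      using p f(1) K_subspace X(1) complex_vector.subspace_diff by blast+
    then have "(p i - p j) + (f i - f j) \<in> X" by (simp add: algebra_simps)
    from null[OF this this] have "bf (p i - p j) (p i - p j) + bf (f i - f j) (f i - f j) = 0"
      unfolding bf_K_sum[OF c mem(1,2) mem(1,2)] .
    then show ?thesis using k(2)[OF c mem(1,2)] by blast
  qed
  have "Cauchy p"
  proof (rule metric_CauchyI)
    fix e :: real assume "e > 0"
    then have "e / k > 0" using k(1) by simp
    then obtain N where N: "\<forall>m\<ge>N. \<forall>n\<ge>N. dist (f m) (f n) < e / k"
      using LIMSEQ_imp_Cauchy[OF lim] metric_CauchyD by blast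
    have "dist (p i) (p j) < e" if "i \<ge> N" "j \<ge> N" for i j
    proof -
      have "dist (f i) (f j) < e / k" using N that by blast
      then have "k * norm (f i - f j) < e"
        using k(1) by (simp add: dist_norm field_simps)
      then show ?thesis using bound[of i j] by (simp add: dist_norm)
    qed
    then show "\<exists>M. \<forall>m\<ge>M. \<forall>n\<ge>M. dist (p m) (p n) < e" by blast
  qed
  then obtain q where q: "p \<longlonglongrightarrow> q"
    using Cauchy_convergent convergent_def by blast
  have mem: "q \<in> K c" "m \<in> K (- c)"
    using closed_sequentially[OF K_closed p(1) q] closed_sequentially[OF K_closed f(1) lim] by blast+
  have "As (p n + f n) = (S1 (p n) + c *\<^sub>C S2 (p n)) + (S1 (f n) + (- c) *\<^sub>C S2 (f n))" for n
    unfolding adj_add(2)[OF K_D[OF p(1)] K_D[OF f(1)]] K_As[OF p(1)] K_As[OF f(1)] ..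
  then have "(\<lambda>n. As (p n + f n)) \<longlonglongrightarrow> (S1 q + c *\<^sub>C S2 q) + (S1 m + (- c) *\<^sub>C S2 m)"
    by (simp only:) (intro tendsto_add scaleC.tendsto tendsto_const S1.tendsto S2.tendsto q lim)
  from graph_closedD[OF X(2) p(2) tendsto_add[OF q lim] this]
  show "m \<in> component c X"
    unfolding component_def using mem by blast
qed

text \<open>The residual \<open>z\<close> of the \<open>S2\<close>-projection \<open>v\<close> of
  \<open>m\<close> is form-orthogonal to all of \<open>X\<close>. By self-adjointness it lies in
  \<open>X\<close>, hence in the component, to which it is \<open>S2\<close>-orthogonal; so it
  vanishes.\<close>

lemma component_full:
  assumes c: "c \<in> {\<i>, - \<i>}" and X: "csubspace X" "graph_closed X" "D0 \<subseteq> X" "X \<subseteq> D"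
    and selfadj: "X = {y \<in> D. \<forall>x\<in>X. bf x y = 0}"
  shows "component c X = K (- c)"
proof
  show "component c X \<subseteq> K (- c)" unfolding component_def by blast
  show "K (- c) \<subseteq> component c X"
  proof
    fix m assume m: "m \<in> K (- c)"
    have null: "bf x y = 0" if "x \<in> X" "y \<in> X" for x y
      using that selfadj by blast
    have closed: "closed (component c X)"
      using component_closed[OF c X(1,2) null] .
    obtain v where v: "v \<in> component c X"
        "\<And>m'. m' \<in> component c X \<Longrightarrow> cinner (S2 v) m' = cinner (S2 m) m'"
      using coercive_representation[OF component_subspace[OF X(1)] closed S2 \<mu>_pos S2_ge] by blast
    define z where "z = m - v"
    have vK: "v \<in> K (- c)" using v(1) unfolding component_def by blast
    have zK: "z \<in> K (- c)"
      unfolding z_def using complex_vector.subspace_diff[OF K_subspace m vK] .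
    have S2_z: "cinner (S2 z) m' = 0" if "m' \<in> component c X" for m'
      unfolding z_def using v(2)[OF that] by (simp add: S2.diff cinner_simps)
    have zero: "0 \<in> D0" "0 \<in> K c"
      using complex_vector.subspace_0 D0_subspace K_subspace by blast+
    have "bf x z = 0" if "x \<in> X" for x
    proof -
      have "x \<in> D" using that X(4) by blast
      then obtain x0 p m' where x: "x0 \<in> D0" "p \<in> K c" "m' \<in> K (- c)" "x = x0 + p + m'"
        using decomposition_exists[OF c] by blast
      have "x - x0 \<in> X"
        using complex_vector.subspace_diff[OF X(1) that] x(1) X(3) by blast
      then have "p + m' \<in> X" using x(4) by (simp add: algebra_simps)
      then have m': "m' \<in> component c X" unfolding component_def using x(2,3) by blast
      have cc: "cnj (- c) = - (- c)" using c by auto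
      have "bf x (0 + 0 + z) = bf p 0 + bf m' z"
        unfolding x(4) using bf_decomposition[OF c x(1-3) zero zK] .
      moreover have "bf p 0 = 0" using bf_D0_right[OF zero(1) K_D[OF x(2)]] .
      moreover have "bf m' z = cnj (bf z m')" by (rule bf_commute)
      moreover have "bf z m' = 0"
        using bf_K[OF zK x(3) cc] S2_z[OF m'] by simp
      ultimately show ?thesis by simp
    qed
    then have "z \<in> X" using selfadj K_D[OF zK] by blast
    \<comment> \<open>With \<open>0\<close> as its partner in \<open>K c\<close>, \<open>z\<close>
      is exhibited as an element of the component.\<close>
    then have "0 + z \<in> X" by simp
    then have "z \<in> component c X"
      unfolding component_def using zK zero(2) by blast
    then have "z = 0" using S2_z S2_eq_0_iff by blast
    then show "m \<in> component c X" using v(1) unfolding z_def by simp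
  qed
qed

section \<open>Unitary maps in terms of the boundary form\<close>

lemma unitary_map_iff:
  "unitary_map V bf W (\<lambda>u v. - bf u v) U \<longleftrightarrow>
    linear_op U \<and> dom U = V \<and> ran U = W \<and> (\<forall>\<nu>\<in>V. bf (the (U \<nu>)) (the (U \<nu>)) + bf \<nu> \<nu> = 0)"
proof -
  \<comment> \<open>The form is real on the diagonal and \<open>sqrt\<close> is injective, so equal
    form norms mean equal form values; the minus sign on the target turns this into a vanishing
    sum.\<close>
  have "form_norm (\<lambda>u v. - bf u v) p = form_norm bf m \<longleftrightarrow> bf p p + bf m m = 0" for p m
    unfolding form_norm_def using bf_Im_self[of p] bf_Im_self[of m]
    by (auto simp: complex_eq_iff)
  then show ?thesis unfolding unitary_map_def by simp
qed

lemma linear_op_ran_subspace: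
  assumes "linear_op U"
  shows "csubspace (ran U)"
proof -
  have dom: "csubspace (dom U)" using assms unfolding linear_op_def by blast
  have ran: "ran U = (\<lambda>\<nu>. the (U \<nu>)) ` dom U"
    by (force simp: ran_def dom_def)
  show ?thesis
  proof (rule complex_vector.subspaceI)
    have z: "0 \<in> dom U" using complex_vector.subspace_0[OF dom] .
    then have "the (U (0 *\<^sub>C 0)) = 0 *\<^sub>C the (U 0)"
      using assms unfolding linear_op_def by blast
    then show "0 \<in> ran U" unfolding ran using z by (intro image_eqI[of _ _ 0]) simp_all
  next
    fix x y assume "x \<in> ran U" "y \<in> ran U"
    then obtain u v where uv: "u \<in> dom U" "v \<in> dom U" "x = the (U u)" "y = the (U v)"
      unfolding ran by blast
    then have "x + y = the (U (u + v))" using assms unfolding linear_op_def by metis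
    then show "x + y \<in> ran U"
      unfolding ran using complex_vector.subspace_add[OF dom uv(1,2)] by blast
  next
    fix a x assume "x \<in> ran U"
    then obtain u where u: "u \<in> dom U" "x = the (U u)"
      unfolding ran by blast
    then have "a *\<^sub>C x = the (U (a *\<^sub>C u))" using assms unfolding linear_op_def by metis
    then show "a *\<^sub>C x \<in> ran U"
      unfolding ran using complex_vector.subspace_scale[OF dom u(1)] by blast
  qed
qed

text \<open>\<open>V\<close> and \<open>W\<close> can only be \<open>dom U\<close> and
  \<open>ran U\<close>, and linearity of \<open>U\<close> makes both subspaces.\<close>

lemma partial_unitaries_iff:
  "U \<in> partial_unitaries A S1 S2 \<longleftrightarrow>
    linear_op U \<and> dom U \<subseteq> K (- \<i>) \<and> closed (dom U) \<and> ran U \<subseteq> K \<i> \<and> closed (ran U) \<and>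
    (\<forall>\<nu>\<in>dom U. bf (the (U \<nu>)) (the (U \<nu>)) + bf \<nu> \<nu> = 0)" (is "?L \<longleftrightarrow> ?R")
proof
  assume ?L
  then show ?R
    unfolding partial_unitaries_def ker_plus_eq ker_minus_eq unitary_map_iff by blast
next
  assume R: ?R
  then have "csubspace (dom U)" "csubspace (ran U)"
    using linear_op_ran_subspace unfolding linear_op_def by blast+
  with R show ?L
    unfolding partial_unitaries_def ker_plus_eq ker_minus_eq unitary_map_iff by blast
qed

lemma full_unitaries_iff:
  "U \<in> full_unitaries A S1 S2 \<longleftrightarrow>
    U \<in> partial_unitaries A S1 S2 \<and> dom U = K (- \<i>) \<and> ran U = K \<i>"
  unfolding partial_unitaries_iff full_unitaries_def ker_plus_eq ker_minus_eq mem_Collect_eq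
    unitary_map_iff
  using K_closed[of \<i>] K_closed[of "- \<i>"] by (intro iffI conjI; elim conjE) simp_all

section \<open>The extension attached to a partial unitary\<close>

context
  fixes U :: "'h \<rightharpoonup> 'h"
  assumes U: "U \<in> partial_unitaries A S1 S2"
begin

lemma U_linear: "linear_op U"
  and U_dom: "\<nu> \<in> dom U \<Longrightarrow> \<nu> \<in> K (- \<i>)"
  and U_isometry: "\<nu> \<in> dom U \<Longrightarrow> bf (the (U \<nu>)) (the (U \<nu>)) + bf \<nu> \<nu> = 0"
  and U_dom_closed: "closed (dom U)"
  using U unfolding partial_unitaries_iff by blast+

lemma U_ran:
  assumes "\<nu> \<in> dom U"
  shows "the (U \<nu>) \<in> K \<i>"
proof -
  have "U \<nu> = Some (the (U \<nu>))" using assms by auto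
  then have "the (U \<nu>) \<in> ran U" by (rule ranI)
  then show ?thesis using U unfolding partial_unitaries_iff by blast
qed

lemma U_dom_subspace: "csubspace (dom U)"
  and U_add: "\<nu> \<in> dom U \<Longrightarrow> \<nu>' \<in> dom U \<Longrightarrow> the (U (\<nu> + \<nu>')) = the (U \<nu>) + the (U \<nu>')"
  and U_scale: "\<nu> \<in> dom U \<Longrightarrow> the (U (a *\<^sub>C \<nu>)) = a *\<^sub>C the (U \<nu>)"
  using U_linear unfolding linear_op_def by blast+

lemma extension_domI:
  "u0 \<in> D0 \<Longrightarrow> \<nu> \<in> dom U \<Longrightarrow> u0 + the (U \<nu>) + \<nu> \<in> extension_dom A U"
  unfolding extension_dom_def by blast

lemma extension_domE:
  assumes "x \<in> extension_dom A U"
  obtains u0 \<nu> where "u0 \<in> D0" "\<nu> \<in> dom U" "x = u0 + the (U \<nu>) + \<nu>"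
  using assms unfolding extension_dom_def by blast

text \<open>By uniqueness of the decomposition the graph of \<open>U\<close> can be read off from
  the domain of the extension.\<close>

lemma extension_dom_iff:
  assumes "u0 \<in> D0" "p \<in> K \<i>" "m \<in> K (- \<i>)"
  shows "u0 + p + m \<in> extension_dom A U \<longleftrightarrow> m \<in> dom U \<and> p = the (U m)"
proof
  assume "u0 + p + m \<in> extension_dom A U"
  then obtain v0 \<nu> where v: "v0 \<in> D0" "\<nu> \<in> dom U" "u0 + p + m = v0 + the (U \<nu>) + \<nu>"
    by (rule extension_domE)
  then have "p = the (U \<nu>) \<and> m = \<nu>"
    using decomposition_unique[OF _ assms v(1) U_ran[OF v(2)] U_dom[OF v(2)] v(3)] by blast
  then show "m \<in> dom U \<and> p = the (U m)" using v(2) by blast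
next
  assume "m \<in> dom U \<and> p = the (U m)"
  then show "u0 + p + m \<in> extension_dom A U" using extension_domI[OF assms(1)] by blast
qed

lemma extension_dom_D: "extension_dom A U \<subseteq> D"
proof
  fix x assume "x \<in> extension_dom A U"
  then obtain u0 \<nu> where v: "u0 \<in> D0" "\<nu> \<in> dom U" "x = u0 + the (U \<nu>) + \<nu>"
    by (rule extension_domE)
  show "x \<in> D"
    unfolding v(3) using closure_op_adj(1)[OF v(1)] K_D[OF U_ran[OF v(2)]] K_D[OF U_dom[OF v(2)]]
    by (intro adj_add(1))
qed

lemma U_zero: "0 \<in> dom U" "the (U 0) = 0"
proof -
  show z: "0 \<in> dom U" using complex_vector.subspace_0[OF U_dom_subspace] .
  show "the (U 0) = 0" using U_scale[OF z, of 0] by simp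
qed

lemma D0_extension_dom: "D0 \<subseteq> extension_dom A U"
proof
  fix x assume "x \<in> D0"
  from extension_domI[OF this U_zero(1)] show "x \<in> extension_dom A U"
    by (simp add: U_zero(2))
qed

lemma extension_dom_subspace: "csubspace (extension_dom A U)"
proof (rule complex_vector.subspaceI)
  show "0 \<in> extension_dom A U"
    using D0_extension_dom complex_vector.subspace_0[OF D0_subspace] by blast
next
  fix x y assume "x \<in> extension_dom A U" "y \<in> extension_dom A U"
  then obtain u0 \<nu> v0 \<xi> where v: "u0 \<in> D0" "\<nu> \<in> dom U" "x = u0 + the (U \<nu>) + \<nu>"
    "v0 \<in> D0" "\<xi> \<in> dom U" "y = v0 + the (U \<xi>) + \<xi>"
    by (elim extension_domE)
  have "(u0 + v0) + the (U (\<nu> + \<xi>)) + (\<nu> + \<xi>) \<in> extension_dom A U"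
    using v D0_add complex_vector.subspace_add[OF U_dom_subspace] by (intro extension_domI)
  then show "x + y \<in> extension_dom A U"
    unfolding v(3,6) U_add[OF v(2,5)] by (simp add: algebra_simps)
next
  fix a x assume "x \<in> extension_dom A U"
  then obtain u0 \<nu> where v: "u0 \<in> D0" "\<nu> \<in> dom U" "x = u0 + the (U \<nu>) + \<nu>"
    by (elim extension_domE)
  have "(a *\<^sub>C u0) + the (U (a *\<^sub>C \<nu>)) + (a *\<^sub>C \<nu>) \<in> extension_dom A U"
    using v D0_scale complex_vector.subspace_scale[OF U_dom_subspace] by (intro extension_domI)
  then show "a *\<^sub>C x \<in> extension_dom A U"
    unfolding v(3) U_scale[OF v(2)] by (simp add: scaleC_add_right)
qed

text \<open>The isometry makes the contributions of the two kernels cancel on the diagonal;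
  polarisation extends this to all pairs.\<close>

lemma extension_dom_null:
  assumes "x \<in> extension_dom A U" "y \<in> extension_dom A U"
  shows "bf x y = 0"
proof (rule bf_vanishes_on_subspace[OF extension_dom_subspace extension_dom_D _ assms])
  fix x assume "x \<in> extension_dom A U"
  then obtain u0 \<nu> where v: "u0 \<in> D0" "\<nu> \<in> dom U" "x = u0 + the (U \<nu>) + \<nu>"
    by (rule extension_domE)
  then show "bf x x = 0"
    using bf_decomposition[OF _ v(1) U_ran[OF v(2)] U_dom[OF v(2)] v(1) U_ran[OF v(2)] U_dom[OF v(2)]]
      U_isometry[OF v(2)] by simp
qed

lemma U_tendsto:
  assumes "\<And>n. f n \<in> dom U" "m \<in> dom U" "f \<longlonglongrightarrow> m"
  shows "(\<lambda>n. the (U (f n))) \<longlonglongrightarrow> the (U m)"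
proof -
  obtain k where "k > 0" and k: "\<And>c p m. c \<in> {\<i>, - \<i>} \<Longrightarrow> p \<in> K c \<Longrightarrow> m \<in> K (- c) \<Longrightarrow>
    bf p p + bf m m = 0 \<Longrightarrow> norm p \<le> k * norm m"
    using isometry_bound by blast
  have "norm (the (U (f n)) - the (U m)) \<le> k * norm (f n - m)" for n
  proof -
    have d: "f n - m \<in> dom U"
      using complex_vector.subspace_diff[OF U_dom_subspace assms(1,2)] .
    have "the (U (f n)) = the (U ((f n - m) + m))" by simp
    also have "\<dots> = the (U (f n - m)) + the (U m)" by (rule U_add[OF d assms(2)])
    finally have "the (U (f n)) - the (U m) = the (U (f n - m))" by simp
    then show ?thesis
      using k[OF _ U_ran[OF d] U_dom[OF d] U_isometry[OF d]] by simp
  qed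
  moreover have "(\<lambda>n. k * norm (f n - m)) \<longlonglongrightarrow> k * norm (m - m)"
    by (intro tendsto_intros assms)
  then have "(\<lambda>n. k * norm (f n - m)) \<longlonglongrightarrow> 0" by simp
  ultimately have "(\<lambda>n. the (U (f n)) - the (U m)) \<longlonglongrightarrow> 0"
    by (rule Lim_null_comparison[OF always_eventually[OF allI]])
  then show ?thesis by (simp add: LIM_zero_iff)
qed

text \<open>Graph convergence forces both kernel components to converge. The limit in
  \<open>K (- \<i>)\<close> stays in the closed set \<open>dom U\<close>, and continuity of
  \<open>U\<close> identifies the other limit.\<close>

lemma extension_dom_closed: "graph_closed (extension_dom A U)"
  unfolding graph_closed_def
proof (intro allI impI)
  fix f x y assume "\<forall>n. f n \<in> extension_dom A U" and lim: "f \<longlonglongrightarrow> x" "(\<lambda>n. As (f n)) \<longlonglongrightarrow> y"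
  then have "\<forall>n. \<exists>u0 \<nu>. u0 \<in> D0 \<and> \<nu> \<in> dom U \<and> f n = u0 + the (U \<nu>) + \<nu>"
    using extension_domE by metis
  then obtain u m where um: "\<And>n. u n \<in> D0" "\<And>n. m n \<in> dom U" "\<And>n. f n = u n + the (U (m n)) + m n"
    by metis
  have mem: "\<And>n. the (U (m n)) \<in> K \<i>" "\<And>n. m n \<in> K (- \<i>)"
    using U_ran[OF um(2)] U_dom[OF um(2)] by blast+
  have "f n \<in> D" for n
    unfolding um(3) using extension_domI[OF um(1,2)] extension_dom_D by blast
  then have x: "x \<in> D" "As x = y"
    using adj_closed[OF _ lim] by blast+
  obtain x0 q r where xd: "x0 \<in> D0" "q \<in> K \<i>" "r \<in> K (- \<i>)" "x = x0 + q + r"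
    using decomposition_exists[OF _ x(1), of \<i>] by blast
  note lim' = lim[folded x(2), unfolded um(3) xd(4)]
  have "m \<longlonglongrightarrow> r"
    using component_tendsto[OF _ um(1) mem xd(1-3) lim'] by simp
  \<comment> \<open>The convergence result concerns the last summand; reordering and taking
    \<open>- \<i>\<close> for \<open>c\<close> brings the \<open>K \<i>\<close> parts into that
    position.\<close>
  have swap: "u n + m n + the (U (m n)) = u n + the (U (m n)) + m n" "x0 + r + q = x0 + q + r" for n
    by (simp_all add: algebra_simps)
  have "(\<lambda>n. the (U (m n))) \<longlonglongrightarrow> q"
    using component_tendsto[of "- \<i>" u m "\<lambda>n. the (U (m n))" x0 r q] um(1) mem xd(1-3) lim'
    unfolding swap by simp
  moreover have r: "r \<in> dom U"
    using closed_sequentially[OF U_dom_closed um(2) \<open>m \<longlonglongrightarrow> r\<close>] .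
  ultimately have "q = the (U r)"
    using U_tendsto[OF um(2) r \<open>m \<longlonglongrightarrow> r\<close>] LIMSEQ_unique by blast
  then show "x \<in> extension_dom A U"
    unfolding xd(4) using extension_domI[OF xd(1) r] by simp
qed

end

section \<open>The correspondence between realisations and unitary maps\<close>

lemma partial_unitary_exists:
  assumes X: "csubspace X" "D0 \<subseteq> X" "X \<subseteq> D" "graph_closed X"
    and null: "\<And>x y. x \<in> X \<Longrightarrow> y \<in> X \<Longrightarrow> bf x y = 0"
  obtains U where "U \<in> partial_unitaries A S1 S2" "extension_dom A U = X"
    "dom U = component \<i> X" "ran U = component (- \<i>) X"
proof -
  let ?V = "component \<i> X"
  have i: "\<i> \<in> {\<i>, - \<i>}" "- \<i> \<in> {\<i>, - \<i>}" by simp_all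
  have cnj_i: "cnj \<i> = - \<i>" by simp
  have V: "m \<in> ?V \<longleftrightarrow> m \<in> K (- \<i>) \<and> (\<exists>p\<in>K \<i>. p + m \<in> X)" for m
    unfolding component_def by blast
  \<comment> \<open>Two partners of the same \<open>m\<close> differ by an element of
    \<open>X\<close> in \<open>K \<i>\<close>, where the form is definite but vanishes on
    \<open>X\<close>. So \<open>X\<close> is a graph over its \<open>K (- \<i>)\<close> component,
    modulo \<open>D0\<close>.\<close>
  have unique: "p = p'" if p: "p \<in> K \<i>" "p' \<in> K \<i>" "p + m \<in> X" "p' + m \<in> X" for p p' m
  proof -
    have "p - p' \<in> X"
      using complex_vector.subspace_diff[OF X(1) p(3,4)] by simp
    from null[OF this this] have "cinner (S2 (p - p')) (p - p') = 0"
      using complex_vector.subspace_diff[OF K_subspace p(1,2)] bf_K[OF _ _ cnj_i] by simp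
    then show ?thesis using S2_eq_0_iff by simp
  qed
  define g where "g m = (SOME p. p \<in> K \<i> \<and> p + m \<in> X)" for m
  have g: "g m \<in> K \<i>" "g m + m \<in> X" if "m \<in> ?V" for m
  proof -
    have "\<exists>p. p \<in> K \<i> \<and> p + m \<in> X" using that V by blast
    from someI_ex[OF this] show "g m \<in> K \<i>" "g m + m \<in> X" unfolding g_def by blast+
  qed
  have g_eq: "g m = p" if "m \<in> K (- \<i>)" "p \<in> K \<i>" "p + m \<in> X" for m p
  proof -
    have "m \<in> ?V" using that V by blast
    from unique[OF g(1)[OF this] that(2) g(2)[OF this] that(3)] show ?thesis .
  qed
  define U where "U m = (if m \<in> ?V then Some (g m) else None)" for m
  have dom_U: "dom U = ?V" unfolding U_def dom_def by auto
  have U_g: "the (U m) = g m" if "m \<in> ?V" for m unfolding U_def using that by simp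
  have VK: "m \<in> K (- \<i>)" if "m \<in> ?V" for m using that V by blast
  have V_sub: "csubspace ?V" by (rule component_subspace[OF X(1)])
  have "linear_op U"
    unfolding linear_op_def dom_U
  proof (intro conjI ballI allI V_sub)
    fix u v assume uv: "u \<in> ?V" "v \<in> ?V"
    have uv': "u + v \<in> ?V" using complex_vector.subspace_add[OF V_sub uv] .
    have "g u + g v + (u + v) = (g u + u) + (g v + v)" by (simp add: algebra_simps)
    then have "g u + g v + (u + v) \<in> X"
      using complex_vector.subspace_add[OF X(1) g(2)[OF uv(1)] g(2)[OF uv(2)]] by (simp only:)
    then have "g (u + v) = g u + g v"
      using complex_vector.subspace_add[OF K_subspace g(1)[OF uv(1)] g(1)[OF uv(2)]]
      by (intro g_eq VK[OF uv'])
    then show "the (U (u + v)) = the (U u) + the (U v)"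
      using U_g uv uv' by simp
  next
    fix a u assume u: "u \<in> ?V"
    have u': "a *\<^sub>C u \<in> ?V" using complex_vector.subspace_scale[OF V_sub u] .
    have "a *\<^sub>C g u + a *\<^sub>C u \<in> X"
      using complex_vector.subspace_scale[OF X(1) g(2)[OF u], of a] by (simp add: scaleC_add_right)
    then have "g (a *\<^sub>C u) = a *\<^sub>C g u"
      using complex_vector.subspace_scale[OF K_subspace g(1)[OF u]]
      by (intro g_eq VK[OF u'])
    then show "the (U (a *\<^sub>C u)) = a *\<^sub>C the (U u)"
      using U_g u u' by simp
  qed
  have ran_U: "ran U = component (- \<i>) X"
  proof
    show "ran U \<subseteq> component (- \<i>) X"
    proof
      fix p assume "p \<in> ran U"
      then obtain m where "U m = Some p" unfolding ran_def by blast
      then have m: "m \<in> ?V" "p = g m" unfolding U_def by (simp_all split: if_splits)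
      then have "m + p \<in> X" using g(2)[OF m(1)] by (simp add: add.commute)
      then show "p \<in> component (- \<i>) X"
        unfolding component_def using g(1)[OF m(1)] VK[OF m(1)] m(2) by auto
    qed
    show "component (- \<i>) X \<subseteq> ran U"
    proof
      fix p assume "p \<in> component (- \<i>) X"
      then obtain m where m: "p \<in> K \<i>" "m \<in> K (- \<i>)" "p + m \<in> X"
        unfolding component_def by (auto simp: add.commute)
      then have "m \<in> ?V" "g m = p" using V g_eq by blast+
      then have "U m = Some p" unfolding U_def by simp
      then show "p \<in> ran U" by (rule ranI)
    qed
  qed
  have "bf (the (U m)) (the (U m)) + bf m m = 0" if "m \<in> dom U" for m
  proof -
    have m: "m \<in> ?V" using that dom_U by simp
    show ?thesis
      using null[OF g(2)[OF m] g(2)[OF m]] bf_K_sum[OF i(1) g(1)[OF m] VK[OF m] g(1)[OF m] VK[OF m]]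
      by (simp add: U_g[OF m])
  qed
  moreover have "closed (dom U)" "closed (ran U)"
    unfolding dom_U ran_U using component_closed[OF _ X(1,4) null] i by blast+
  moreover have "dom U \<subseteq> K (- \<i>)" "ran U \<subseteq> K \<i>"
    unfolding dom_U ran_U component_def by auto
  ultimately have U: "U \<in> partial_unitaries A S1 S2"
    unfolding partial_unitaries_iff using \<open>linear_op U\<close> by blast
  have "extension_dom A U = X"
  proof
    show "extension_dom A U \<subseteq> X"
    proof
      fix x assume "x \<in> extension_dom A U"
      then obtain u0 m where um: "u0 \<in> D0" "m \<in> dom U" "x = u0 + the (U m) + m"
        by (rule extension_domE[OF U])
      then have x: "u0 \<in> D0" "m \<in> ?V" "x = u0 + g m + m"
        using dom_U U_g by simp_all
      have "u0 + (g m + m) \<in> X"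
        using complex_vector.subspace_add[OF X(1) _ g(2)[OF x(2)]] x(1) X(2) by blast
      then show "x \<in> X" using x(3) by (simp add: add.assoc)
    qed
    show "X \<subseteq> extension_dom A U"
    proof
      fix x assume "x \<in> X"
      then obtain u0 p m where x: "u0 \<in> D0" "p \<in> K \<i>" "m \<in> K (- \<i>)" "x = u0 + p + m"
        using decomposition_exists[OF i(1)] X(3) by blast
      have "x - u0 \<in> X"
        using complex_vector.subspace_diff[OF X(1) \<open>x \<in> X\<close>] x(1) X(2) by blast
      then have "p + m \<in> X" using x(4) by (simp add: algebra_simps)
      then have "m \<in> ?V" "g m = p" using V g_eq x by blast+
      then show "x \<in> extension_dom A U"
        using extension_dom_iff[OF U x(1-3)] dom_U U_g x(4) by simp
    qed
  qed
  then show thesis using that U dom_U ran_U by blast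
qed

text \<open>The operator determines its domain, and the membership of
  \<open>0 + the (U m) + m\<close> in it determines the value of \<open>U\<close> at
  \<open>m\<close>.\<close>

lemma extension_inj: "inj_on (extension A) (partial_unitaries A S1 S2)"
proof (rule inj_onI)
  have le: "U \<subseteq>\<^sub>m U'"
    if U: "U \<in> partial_unitaries A S1 S2" and U': "U' \<in> partial_unitaries A S1 S2"
      and eq: "extension_dom A U = extension_dom A U'" for U U'
    unfolding map_le_def
  proof
    fix m assume m: "m \<in> dom U"
    have z: "0 \<in> D0" using complex_vector.subspace_0[OF D0_subspace] .
    have "m \<in> dom U' \<and> the (U m) = the (U' m)"
      using extension_domI[OF U z m] extension_dom_iff[OF U' z U_ran[OF U m] U_dom[OF U m]] eq by blast
    then show "U m = U' m" using m by auto
  qed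
  fix U U' assume U: "U \<in> partial_unitaries A S1 S2" "U' \<in> partial_unitaries A S1 S2"
    "extension A U = extension A U'"
  then have "extension_dom A U = extension_dom A U'"
    unfolding extension_def using restrict_eq_iff extension_dom_D by metis
  then show "U = U'"
    using le[OF U(1,2)] le[OF U(2,1)] by (intro map_le_antisym) simp_all
qed

lemma dom_subset_extension_dom:
  "U \<in> partial_unitaries A S1 S2 \<Longrightarrow> dom A \<subseteq> extension_dom A U"
  using D0_extension_dom dom_subset_D0 by blast

lemma extension_closed_symmetric:
  assumes U: "U \<in> partial_unitaries A S1 S2"
  shows "realisation A (extension A U)" "closed_op (extension A U)" "symmetric_op (extension A U)"
proof -
  show "realisation A (extension A U)"
    unfolding realisation_iff extension_def
    using extension_dom_subspace[OF U] dom_subset_extension_dom[OF U] extension_dom_D[OF U] by blast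
  show "closed_op (extension A U)"
    unfolding extension_def closed_op_restrict_iff[OF extension_dom_D[OF U]]
    by (rule extension_dom_closed[OF U])
  show "symmetric_op (extension A U)"
    unfolding extension_def symmetric_op_restrict_iff[OF extension_dom_D[OF U]]
    using extension_dom_null[OF U] by blast
qed

text \<open>For surjectivity, the domain of a closed symmetric realisation is graph-closed, hence
  contains \<open>D0\<close>, and the form vanishes on it. The partial unitary built from its
  components then gives it back.\<close>

lemma extension_bij_closed_symmetric:
  "bij_betw (extension A) (partial_unitaries A S1 S2)
     {B. realisation A B \<and> closed_op B \<and> symmetric_op B}"
  unfolding bij_betw_def
proof (intro conjI extension_inj equalityI subsetI)
  fix B assume "B \<in> extension A ` partial_unitaries A S1 S2"
  then show "B \<in> {B. realisation A B \<and> closed_op B \<and> symmetric_op B}"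
    using extension_closed_symmetric by blast
next
  fix B assume B: "B \<in> {B. realisation A B \<and> closed_op B \<and> symmetric_op B}"
  then obtain X where X: "B = adjoint_op A |` X" "csubspace X" "dom A \<subseteq> X" "X \<subseteq> D"
    unfolding realisation_iff by blast
  have closed: "graph_closed X" and null: "\<And>x y. x \<in> X \<Longrightarrow> y \<in> X \<Longrightarrow> bf x y = 0"
    using B unfolding X(1) mem_Collect_eq closed_op_restrict_iff[OF X(4)] symmetric_op_restrict_iff[OF X(4)]
    by blast+
  obtain U where U: "U \<in> partial_unitaries A S1 S2" "extension_dom A U = X"
    "dom U = component \<i> X" "ran U = component (- \<i>) X"
    using partial_unitary_exists[OF X(2) graph_closed_D0[OF closed X(3)] X(4) closed null] by blast
  have "extension A U = B" unfolding extension_def X(1) U(2) ..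
  then show "B \<in> extension A ` partial_unitaries A S1 S2" using U(1) by blast
qed

text \<open>Let \<open>y\<close>, with kernel components \<open>p\<close> and \<open>m\<close>, be
  form-orthogonal to the domain. Since \<open>U\<close> is everywhere defined, the defect
  \<open>w = p - the (U m)\<close> makes sense; since it is onto, \<open>w\<close> has a preimage
  \<open>n\<close>, and testing with \<open>w + n\<close> gives \<open>bf w w = 0\<close>.\<close>

lemma extension_selfadjoint:
  assumes "U \<in> full_unitaries A S1 S2"
  shows "selfadjoint_op (extension A U)"
proof -
  have U: "U \<in> partial_unitaries A S1 S2" and dom: "dom U = K (- \<i>)" and ran: "ran U = K \<i>"
    using assms unfolding full_unitaries_iff by blast+
  let ?X = "extension_dom A U"
  have i: "\<i> \<in> {\<i>, - \<i>}" by simp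
  have z: "0 \<in> D0" "0 \<in> K (- \<i>)"
    using complex_vector.subspace_0 D0_subspace K_subspace by blast+
  have "y \<in> ?X" if y: "y \<in> D" "\<forall>x\<in>?X. bf x y = 0" for y
  proof -
    obtain y0 p m where d: "y0 \<in> D0" "p \<in> K \<i>" "m \<in> K (- \<i>)" "y = y0 + p + m"
      using decomposition_exists[OF i y(1)] by blast
    have m: "m \<in> dom U" using d(3) dom by simp
    define w where "w = p - the (U m)"
    have "w \<in> K \<i>"
      unfolding w_def using complex_vector.subspace_diff[OF K_subspace d(2) U_ran[OF U m]] .
    then have "w \<in> ran U" using ran by simp
    then obtain n where n: "U n = Some w" unfolding ran_def by blast
    then have n': "n \<in> dom U" "the (U n) = w" by auto
    have nK: "n \<in> K (- \<i>)" using n'(1) dom by simp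
    have "0 + w + n \<in> ?X" using extension_domI[OF U z(1) n'(1)] n'(2) by simp
    then have "bf (0 + w + n) y = 0" using y(2) by blast
    then have *: "bf w p + bf n m = 0"
      unfolding d(4) using bf_decomposition[OF i z(1) \<open>w \<in> K \<i>\<close> nK d(1-3)] by simp
    have "bf (0 + w + n) (0 + the (U m) + m) = 0"
      using extension_dom_null[OF U] extension_domI[OF U z(1) m] \<open>0 + w + n \<in> ?X\<close> by blast
    then have "bf w (the (U m)) + bf n m = 0"
      using bf_decomposition[OF i z(1) \<open>w \<in> K \<i>\<close> nK z(1) U_ran[OF U m] d(3)] by simp
    \<comment> \<open>Both pairings contain the same term \<open>bf n m\<close>, so it drops
      out.\<close>
    then have "bf w p = bf w (the (U m))" using * by (metis add_right_cancel)
    then have "bf w w = 0"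
      unfolding w_def using bf_diff_right[OF K_D[OF d(2)] K_D[OF U_ran[OF U m]]] by simp
    then have "w = 0"
      using bf_K[OF \<open>w \<in> K \<i>\<close> \<open>w \<in> K \<i>\<close>] S2_eq_0_iff by simp
    then have "p = the (U m)" unfolding w_def by simp
    then show ?thesis
      unfolding d(4) using extension_domI[OF U d(1) m] by simp
  qed
  then have "?X = {y \<in> D. \<forall>x\<in>?X. bf x y = 0}"
    using extension_dom_null[OF U] extension_dom_D[OF U] by blast
  then show ?thesis
    unfolding extension_def
    by (subst selfadjoint_op_restrict_iff[OF dom_subset_extension_dom[OF U] extension_dom_D[OF U]])
qed

lemma extension_bij_selfadjoint:
  "bij_betw (extension A) (full_unitaries A S1 S2) {B. realisation A B \<and> selfadjoint_op B}"
  unfolding bij_betw_def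
proof (intro conjI equalityI subsetI)
  show "inj_on (extension A) (full_unitaries A S1 S2)"
    by (rule inj_on_subset[OF extension_inj]) (simp add: full_unitaries_iff subset_iff)
next
  fix B assume "B \<in> extension A ` full_unitaries A S1 S2"
  then show "B \<in> {B. realisation A B \<and> selfadjoint_op B}"
    using extension_closed_symmetric(1) extension_selfadjoint full_unitaries_iff by blast
next
  fix B assume B: "B \<in> {B. realisation A B \<and> selfadjoint_op B}"
  then obtain X where X: "B = adjoint_op A |` X" "csubspace X" "dom A \<subseteq> X" "X \<subseteq> D"
    unfolding realisation_iff by blast
  have sa: "X = {y \<in> D. \<forall>x\<in>X. bf x y = 0}"
    using B unfolding X(1) mem_Collect_eq by (simp only: selfadjoint_op_restrict_iff[OF X(3,4)])
  have closed: "graph_closed X" by (rule graph_closed_selfadjoint[OF sa])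
  have null: "\<And>x y. x \<in> X \<Longrightarrow> y \<in> X \<Longrightarrow> bf x y = 0" using sa by blast
  note D0 = graph_closed_D0[OF closed X(3)]
  obtain U where U: "U \<in> partial_unitaries A S1 S2" "extension_dom A U = X"
    "dom U = component \<i> X" "ran U = component (- \<i>) X"
    using partial_unitary_exists[OF X(2) D0 X(4) closed null] by blast
  \<comment> \<open>The two signs of \<open>c\<close> yield the domain and the range of
    \<open>U\<close>, respectively.\<close>
  have "dom U = K (- \<i>)" "ran U = K \<i>"
    using component_full[OF _ X(2) closed D0 X(4) sa, of \<i>]
      component_full[OF _ X(2) closed D0 X(4) sa, of "- \<i>"] U(3,4) by simp_all
  then have "U \<in> full_unitaries A S1 S2" unfolding full_unitaries_iff using U(1) by blast
  moreover have "extension A U = B" unfolding extension_def X(1) U(2) by simp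
  ultimately show "B \<in> extension A ` full_unitaries A S1 S2" by blast
qed

lemma extension_action:
  assumes U: "U \<in> partial_unitaries A S1 S2"
  shows "dom (extension A U) = extension_dom A U"
    and "u0 \<in> D0 \<Longrightarrow> \<nu> \<in> dom U \<Longrightarrow> extension A U (u0 + the (U \<nu>) + \<nu>) =
      Some (the (closure_op A u0) + (S1 \<nu> - \<i> *\<^sub>C S2 \<nu>) + (S1 (the (U \<nu>)) + \<i> *\<^sub>C S2 (the (U \<nu>))))"
proof -
  show "dom (extension A U) = extension_dom A U"
    unfolding extension_def by (rule restrict_dom[OF extension_dom_D[OF U]])
  assume u0: "u0 \<in> D0" and \<nu>: "\<nu> \<in> dom U"
  let ?x = "u0 + the (U \<nu>) + \<nu>"
  note D = closure_op_adj(1)[OF u0] K_D[OF U_ran[OF U \<nu>]] K_D[OF U_dom[OF U \<nu>]]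
  have x: "?x \<in> extension_dom A U" by (rule extension_domI[OF U u0 \<nu>])
  then have "?x \<in> D" using extension_dom_D[OF U] by blast
  then have "extension A U ?x = Some (As ?x)"
    unfolding extension_def restrict_map_def using x by auto
  also have "As ?x = As u0 + As (the (U \<nu>)) + As \<nu>"
    using D by (simp add: adj_add del: domIff)
  also have "\<dots> = the (closure_op A u0) + (S1 \<nu> - \<i> *\<^sub>C S2 \<nu>) + (S1 (the (U \<nu>)) + \<i> *\<^sub>C S2 (the (U \<nu>)))"
    unfolding closure_op_adj(2)[OF u0] K_As[OF U_ran[OF U \<nu>]] K_As[OF U_dom[OF U \<nu>]]
    by (simp add: algebra_simps)
  finally show "extension A U ?x = Some (the (closure_op A u0) + (S1 \<nu> - \<i> *\<^sub>C S2 \<nu>)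
      + (S1 (the (U \<nu>)) + \<i> *\<^sub>C S2 (the (U \<nu>))))" .
qed

lemma von_neumann_decomposition: "direct_sum3 D D0 (K \<i>) (K (- \<i>))"
  unfolding direct_sum3_def
proof (intro conjI ballI impI)
  have i: "\<i> \<in> {\<i>, - \<i>}" by simp
  show "D = {x + y + z |x y z. x \<in> D0 \<and> y \<in> K \<i> \<and> z \<in> K (- \<i>)}"
  proof
    show "D \<subseteq> {x + y + z |x y z. x \<in> D0 \<and> y \<in> K \<i> \<and> z \<in> K (- \<i>)}"
    proof
      fix u assume "u \<in> D"
      then obtain x y z where "x \<in> D0" "y \<in> K \<i>" "z \<in> K (- \<i>)" "u = x + y + z"
        using decomposition_exists[OF i] by blast
      then show "u \<in> {x + y + z |x y z. x \<in> D0 \<and> y \<in> K \<i> \<and> z \<in> K (- \<i>)}" by blast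
    qed
    show "{x + y + z |x y z. x \<in> D0 \<and> y \<in> K \<i> \<and> z \<in> K (- \<i>)} \<subseteq> D"
    proof
      fix u assume "u \<in> {x + y + z |x y z. x \<in> D0 \<and> y \<in> K \<i> \<and> z \<in> K (- \<i>)}"
      then obtain x y z where u: "u = x + y + z" "x \<in> D0" "y \<in> K \<i>" "z \<in> K (- \<i>)" by blast
      show "u \<in> D" unfolding u(1)
        by (intro adj_add(1) closure_op_adj(1)[OF u(2)] K_D[OF u(3)] K_D[OF u(4)])
    qed
  qed
  fix x y z x' y' z'
  assume *: "x \<in> D0" "y \<in> K \<i>" "z \<in> K (- \<i>)" "x' \<in> D0" "y' \<in> K \<i>" "z' \<in> K (- \<i>)"
    "x + y + z = x' + y' + z'"
  from decomposition_unique[OF i *] show "x = x'" "y = y'" "z = z'" by blast+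
qed

end

section \<open>Deficiency spaces as an instance, and assembly of the result\<close>

lemma symmetric_perturbation_deficiency:
  fixes A :: "'h::chilbert_space \<rightharpoonup> 'h"
  assumes "symmetric_operator A" "\<beta> > 0"
  shows "symmetric_perturbation A (\<lambda>u. 0) (\<lambda>u. complex_of_real \<beta> *\<^sub>C u) \<beta>"
proof (rule symmetric_perturbation.intro[OF assms(1)], rule symmetric_perturbation_axioms.intro)
  show "bounded_linear (\<lambda>u::'h. 0::'h)" by (rule bounded_linear_zero)
  show "bounded_linear (\<lambda>u::'h. complex_of_real \<beta> *\<^sub>C u)" by (rule scaleC.bounded_linear_right)
qed (simp_all add: assms(2) scaleC_scaleC mult.commute cinner_scaleC_left cinner_scaleC_right cinner_self)

lemma deficiency_eq:
  fixes A :: "'h::chilbert_space \<rightharpoonup> 'h"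
  assumes "symmetric_operator A" "\<beta> > 0"
  shows "deficiency_plus \<beta> A =
      hilbert_dim (symmetric_perturbation.K A (\<lambda>u. 0) (\<lambda>u. complex_of_real \<beta> *\<^sub>C u) \<i>)"
    and "deficiency_minus \<beta> A =
      hilbert_dim (symmetric_perturbation.K A (\<lambda>u. 0) (\<lambda>u. complex_of_real \<beta> *\<^sub>C u) (- \<i>))"
proof -
  note ker = symmetric_perturbation.op_ker_perturb_adjoint[OF symmetric_perturbation_deficiency[OF assms]]
  \<comment> \<open>Puts the shift into the form \<open>- (S1 u + c *\<^sub>C S2 u)\<close> of this
    instance, so that the kernel becomes a space \<open>K\<close>.\<close>
  have "- ((\<i> * complex_of_real \<beta>) *\<^sub>C u) = - (0 + \<i> *\<^sub>C complex_of_real \<beta> *\<^sub>C u)" for u :: 'h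
    by (simp only: scaleC_scaleC add_0_left)
  then show "deficiency_plus \<beta> A =
      hilbert_dim (symmetric_perturbation.K A (\<lambda>u. 0) (\<lambda>u. complex_of_real \<beta> *\<^sub>C u) \<i>)"
    unfolding deficiency_plus_def by (subst ker[where c = \<i>]) simp_all
  have "(\<i> * complex_of_real \<beta>) *\<^sub>C u = - (0 + (- \<i>) *\<^sub>C complex_of_real \<beta> *\<^sub>C u)" for u :: 'h
    by (simp only: scaleC_scaleC add_0_left mult_minus_left scaleC.minus_left minus_minus)
  then show "deficiency_minus \<beta> A =
      hilbert_dim (symmetric_perturbation.K A (\<lambda>u. 0) (\<lambda>u. complex_of_real \<beta> *\<^sub>C u) (- \<i>))"
    unfolding deficiency_minus_def by (subst ker[where c = "- \<i>"]) simp_all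
qed

theorem corollary5p1:
  fixes A :: "'h::chilbert_space \<rightharpoonup> 'h" and S\<^sub>1 S\<^sub>2 :: "'h \<Rightarrow> 'h"
  assumes "linear_op A" and "densely_defined A" and "symmetric_op A"
    and "bounded_selfadjoint S\<^sub>1" and "bounded_selfadjoint S\<^sub>2" and "strictly_positive S\<^sub>2"
  shows
    "\<comment> \<open>(i)\<close>
     (\<forall>\<beta>>0. hilbert_dim (ker_plus A S\<^sub>1 S\<^sub>2) =o deficiency_plus \<beta> A \<and>
            hilbert_dim (ker_minus A S\<^sub>1 S\<^sub>2) =o deficiency_minus \<beta> A) \<and>
     \<comment> \<open>(ii)\<close>
     direct_sum3 (dom (adjoint_op A))
       (dom (closure_op A)) (ker_plus A S\<^sub>1 S\<^sub>2) (ker_minus A S\<^sub>1 S\<^sub>2) \<and>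
     form_orthogonal (boundary_form A) (dom (closure_op A)) (ker_plus A S\<^sub>1 S\<^sub>2) \<and>
     form_orthogonal (boundary_form A) (dom (closure_op A)) (ker_minus A S\<^sub>1 S\<^sub>2) \<and>
     form_orthogonal (boundary_form A) (ker_plus A S\<^sub>1 S\<^sub>2) (ker_minus A S\<^sub>1 S\<^sub>2) \<and>
     \<comment> \<open>(iii), with the correspondence of (v)\<close>
     bij_betw (extension A) (partial_unitaries A S\<^sub>1 S\<^sub>2)
       {B. realisation A B \<and> closed_op B \<and> symmetric_op B} \<and>
     \<comment> \<open>(iv), with the correspondence of (v)\<close>
     bij_betw (extension A) (full_unitaries A S\<^sub>1 S\<^sub>2)
       {B. realisation A B \<and> selfadjoint_op B} \<and>
     \<comment> \<open>(v): domain and action of the extension attached to \<open>U\<close>\<close>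
     (\<forall>U \<in> partial_unitaries A S\<^sub>1 S\<^sub>2 \<union> full_unitaries A S\<^sub>1 S\<^sub>2.
        dom (extension A U) = extension_dom A U \<and>
        (\<forall>u\<^sub>0 \<in> dom (closure_op A). \<forall>\<nu> \<in> dom U.
           extension A U (u\<^sub>0 + the (U \<nu>) + \<nu>) =
             Some (the (closure_op A u\<^sub>0) + (S\<^sub>1 \<nu> - \<i> *\<^sub>C S\<^sub>2 \<nu>)
                   + (S\<^sub>1 (the (U \<nu>)) + \<i> *\<^sub>C S\<^sub>2 (the (U \<nu>))))))"
proof -
  obtain \<mu> where \<mu>: "\<mu> > 0" "\<And>u. \<mu> * (norm u)\<^sup>2 \<le> Re (cinner (S\<^sub>2 u) u)"
    using assms(6) unfolding strictly_positive_def by blast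
  interpret symmetric_operator A
    by (rule symmetric_operator.intro[OF assms(1-3)])
  have S: "bounded_linear S\<^sub>1" "\<And>c u. S\<^sub>1 (c *\<^sub>C u) = c *\<^sub>C S\<^sub>1 u"
    "bounded_linear S\<^sub>2" "\<And>c u. S\<^sub>2 (c *\<^sub>C u) = c *\<^sub>C S\<^sub>2 u"
    using assms(4,5) unfolding bounded_selfadjoint_def by blast+
  interpret symmetric_perturbation A S\<^sub>1 S\<^sub>2 \<mu>
    by (rule symmetric_perturbation.intro[OF symmetric_operator_axioms],
        rule symmetric_perturbation_axioms.intro[OF S(1,2) bounded_selfadjoint_cinner[OF assms(4)]
          S(3,4) bounded_selfadjoint_cinner[OF assms(5)] \<mu>])
  have i: "\<i> \<in> {\<i>, - \<i>}" "- \<i> \<in> {\<i>, - \<i>}" by simp_all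
  have dim: "hilbert_dim (K c) =o hilbert_dim (symmetric_perturbation.K A (\<lambda>u. 0)
      (\<lambda>u. complex_of_real \<beta> *\<^sub>C u) c)" if "\<beta> > 0" "c \<in> {\<i>, - \<i>}" for \<beta> c
  proof -
    note * = symmetric_perturbation_deficiency[OF symmetric_operator_axioms that(1)]
    show ?thesis
      \<comment> \<open>Either pair of operators can play either role in the comparison, which gives
        both inequalities.\<close>
      unfolding ordIso_iff_ordLeq
      using hilbert_dim_K_le[OF symmetric_perturbation_axioms * that(2)]
        hilbert_dim_K_le[OF * symmetric_perturbation_axioms that(2)] by blast
  qed
  note deficiency = deficiency_eq[OF symmetric_operator_axioms]
  have dims: "\<forall>\<beta>>0. hilbert_dim (K \<i>) =o deficiency_plus \<beta> A \<and> hilbert_dim (K (- \<i>)) =o deficiency_minus \<beta> A"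
    using dim deficiency i by simp
  have orthogonal_closure: "form_orthogonal bf D0 (K c)" for c
    unfolding form_orthogonal_def using bf_D0_left K_D by blast
  have orthogonal_K: "form_orthogonal bf (K \<i>) (K (- \<i>))"
    unfolding form_orthogonal_def using bf_K_orthogonal by simp
  show ?thesis
    unfolding ker_plus_eq ker_minus_eq
  proof (intro conjI dims von_neumann_decomposition orthogonal_closure orthogonal_K
      extension_bij_closed_symmetric extension_bij_selfadjoint ballI)
    fix U assume "U \<in> partial_unitaries A S\<^sub>1 S\<^sub>2 \<union> full_unitaries A S\<^sub>1 S\<^sub>2"
    \<comment> \<open>A full unitary is a partial one because both kernels are closed
      subspaces.\<close>
    then have U: "U \<in> partial_unitaries A S\<^sub>1 S\<^sub>2"
      using full_unitaries_iff by blast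
    show "dom (extension A U) = extension_dom A U"
      by (rule extension_action(1)[OF U])
    fix u\<^sub>0 \<nu> assume "u\<^sub>0 \<in> D0" "\<nu> \<in> dom U"
    then show "extension A U (u\<^sub>0 + the (U \<nu>) + \<nu>) =
        Some (the (closure_op A u\<^sub>0) + (S\<^sub>1 \<nu> - \<i> *\<^sub>C S\<^sub>2 \<nu>)
          + (S\<^sub>1 (the (U \<nu>)) + \<i> *\<^sub>C S\<^sub>2 (the (U \<nu>))))"
      by (rule extension_action(2)[OF U])
  qed
qed

end
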